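(* Let $D\ge1$ and let $(G_1,G_2,\dots)$ be a sequence of finite simple graphs with all degrees at most $D$. Assume there is a $\delta>0$ such that for every simple looped graph $H$ in which every node has degree at least $(1-\delta)|H|$, the sequence $\frac{\ln \mathrm{hom}(G_n,H)}{|G_n|}$ is convergent as $n\to\infty$. Then the sequence $(G_1,G_2,\dots)$ is left-convergent.
   Context: A simple looped graph is a simple graph with a loop added at every node; $|H|$ denotes its number of nodes. $\mathrm{hom}(G,H)$ is the number of maps $\phi:V(G)\to V(H)$ such that $\phi(u)\phi(v)\in E(H)$ for every edge $uv\in E(G)$ (images of adjacent nodes may coincide because of the loops). For a graph $G$, node $v$ and integer $r\ge0$, $B_G(v,r)$ is the subgraph induced by the nodes at distance at most $r$ from $v$, rooted at $v$. A sequence $(G_n)$ of graphs with degrees bounded by $D$ is left-convergent if for every integer $r\ge 1$ and every finite rooted graph $U$, the fraction of nodes $v\in V(G_n)$ with $B_{G_n}(v,r)$ isomorphic to $U$ as a rooted graph converges as $n\to\infty$. *)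

theory Defs
  imports "HOL-Analysis.Analysis" "Graph_Theory.Graph_Theory"
begin

text \<open>
  An undirected edge \<open>uv\<close> is a pair of opposite arcs \<open>(u, v)\<close>, \<open>(v, u)\<close>, and a loop is the
  single arc \<open>(v, v)\<close>. Hence \<^const>\<open>pair_graph\<close> describes the finite simple graphs, and
  \<^const>\<open>out_degree\<close> is the number of neighbours of a node, where a looped node is its own
  neighbour (so that a loop contributes 1).
\<close>

definition add_loops :: "'a pair_pre_digraph \<Rightarrow> 'a pair_pre_digraph" where
  "add_loops K = \<lparr>pverts = pverts K, parcs = parcs K \<union> Id_on (pverts K)\<rparr>"

definition simple_looped_graph :: "'a pair_pre_digraph \<Rightarrow> bool" where
  "simple_looped_graph H \<longleftrightarrow> (\<exists>K. pair_graph K \<and> H = add_loops K)"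

definition graph_homs :: "'a pair_pre_digraph \<Rightarrow> 'b pair_pre_digraph \<Rightarrow> ('a \<Rightarrow> 'b) set" where
  "graph_homs G H =
    {\<phi> \<in> pverts G \<rightarrow>\<^sub>E pverts H. \<forall>(u, v) \<in> parcs G. (\<phi> u, \<phi> v) \<in> parcs H}"

definition hom_count :: "'a pair_pre_digraph \<Rightarrow> 'b pair_pre_digraph \<Rightarrow> nat" where
  "hom_count G H = card (graph_homs G H)"

text \<open>The shortest-path length for unit weights; it is \<open>\<infinity>\<close> if there is no walk from \<open>u\<close> to \<open>v\<close>.\<close>

definition graph_dist :: "'a pair_pre_digraph \<Rightarrow> 'a \<Rightarrow> 'a \<Rightarrow> ereal" where
  "graph_dist G u v = wf_digraph.\<mu> (with_proj G) (\<lambda>_. 1) u v"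

definition ball_verts :: "'a pair_pre_digraph \<Rightarrow> 'a \<Rightarrow> nat \<Rightarrow> 'a set" where
  "ball_verts G v r = {u \<in> pverts G. graph_dist G v u \<le> ereal (real r)}"

definition graph_ball :: "'a pair_pre_digraph \<Rightarrow> 'a \<Rightarrow> nat \<Rightarrow> 'a pair_pre_digraph" where
  "graph_ball G v r =
    \<lparr>pverts = ball_verts G v r, parcs = parcs G \<inter> (ball_verts G v r \<times> ball_verts G v r)\<rparr>"

definition rooted_iso ::
  "'a pair_pre_digraph \<Rightarrow> 'a \<Rightarrow> 'b pair_pre_digraph \<Rightarrow> 'b \<Rightarrow> bool" where
  "rooted_iso G v H w \<longleftrightarrow>
    (\<exists>f. bij_betw f (pverts G) (pverts H) \<and> f v = w \<and>
      (\<forall>x \<in> pverts G. \<forall>y \<in> pverts G. (x, y) \<in> parcs G \<longleftrightarrow> (f x, f y) \<in> parcs H))"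

definition ball_frequency ::
  "'a pair_pre_digraph \<Rightarrow> nat \<Rightarrow> 'b pair_pre_digraph \<Rightarrow> 'b \<Rightarrow> real" where
  "ball_frequency G r U w =
    real (card {v \<in> pverts G. rooted_iso (graph_ball G v r) v U w}) / real (card (pverts G))"

text \<open>Up to isomorphism every finite rooted graph \<open>(U, w)\<close> has its nodes in \<^typ>\<open>nat\<close>.\<close>

definition left_convergent :: "(nat \<Rightarrow> 'a pair_pre_digraph) \<Rightarrow> bool" where
  "left_convergent G \<longleftrightarrow>
    (\<forall>r \<ge> 1. \<forall>(U :: nat pair_pre_digraph) w. pair_graph U \<and> w \<in> pverts U \<longrightarrow>
      convergent (\<lambda>n. ball_frequency (G n) r U w))"

end

theory Submission
  imports Defs "HOL-Complex_Analysis.Complex_Analysis"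
begin

text \<open>
  Add \<open>k\<close> universal nodes to a fixed looped graph \<open>Y\<close>. For large \<open>k\<close> the degree condition holds, and
  \<open>hom(G, Y + k) = k^|G| Z(1/k)\<close> where \<open>Z(z)\<close> sums \<open>hom(G[S], Y) z^|S|\<close> over the node sets \<open>S\<close>.
  This \<open>Z\<close> is the independence polynomial of a graph of bounded degree, hence zero-free on a disc
  independent of \<open>G\<close>, where \<open>|ln Z|\<close> is \<open>O(|G|)\<close>. By Cauchy's inequality, convergence of
  \<open>ln Z(1/k) / |G|\<close> for all large \<open>k\<close> forces convergence of every Taylor coefficient of \<open>ln Z / |G|\<close>
  at 0. For a connected graph \<open>F\<close> on \<open>m\<close> nodes, inclusion-exclusion over all subgraphs \<open>Y\<close> of \<open>F\<close>
  applied to the \<open>m\<close>-th coefficient kills every product term of the logarithm and leaves the number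
  of induced copies of \<open>F\<close> in \<open>G\<close>. Finally, the number of nodes with a prescribed ball is a fixed
  linear combination of the numbers of induced copies of connected graphs.
\<close>

section \<open>Moebius inversion over finite sets\<close>

text \<open>The coefficients of Z count node sets of every kind, disconnected ones included, and can
  grow like powers of |G|; only the logarithm is O(|G|). The price is that a coefficient of ln Z
  mixes products of counts. Inclusion-exclusion is linear and acts on the target only, so it
  commutes with the limit: the hypothesis is applied to each of the finitely many Y inside F
  separately, and the alternating sum is taken afterwards. A product survives only if F is covered
  by two subgraphs with at most m nodes in total, hence by two disjoint nonempty ones with no edge
  between them, which a connected F excludes. The loops of the target do no harm at order m: a
  homomorphism from m nodes onto all m nodes of F is injective, so no edge is mapped to a loop, and
  hitting exactly the edges of F makes the copy induced. Only the values of ln Z at the points 1/k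
  with k large are known. These accumulate at 0, and the uniform bound on a common disc turns them
  into coefficients one degree at a time, with n going to infinity before k.\<close>

definition mobius :: "('a set \<Rightarrow> complex) \<Rightarrow> 'a set \<Rightarrow> complex" where
  "mobius f S = (\<Sum>T\<in>Pow S. (-1) ^ card (S - T) * f T)"

lemma mobius_cong:
  "(\<And>T. T \<subseteq> S \<Longrightarrow> f T = g T) \<Longrightarrow> mobius f S = mobius g S"
  unfolding mobius_def by (intro sum.cong) auto

lemma mobius_diff: "mobius (\<lambda>T. f T - g T) S = mobius f S - mobius g S"
  unfolding mobius_def by (simp add: algebra_simps sum_subtractf)

lemma mobius_sum: "mobius (\<lambda>T. \<Sum>i\<in>I. f i T) S = (\<Sum>i\<in>I. mobius (f i) S)"
  unfolding mobius_def by (subst sum.swap) (simp add: sum_distrib_left)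

lemma mobius_cmult: "mobius (\<lambda>T. c * f T) S = c * mobius f S"
  unfolding mobius_def by (simp add: sum_distrib_left mult.left_commute)

lemma sum_Pow_insert:
  fixes f :: "'a set \<Rightarrow> 'b::comm_monoid_add"
  assumes "finite S" "x \<notin> S"
  shows "(\<Sum>T\<in>Pow (insert x S). f T) = (\<Sum>T\<in>Pow S. f T) + (\<Sum>T\<in>Pow S. f (insert x T))"
proof -
  have "inj_on (insert x) (Pow S)"
    using assms(2) by (auto simp: inj_on_def)
  moreover have "Pow S \<inter> insert x ` Pow S = {}"
    using assms(2) by auto
  ultimately show ?thesis
    using assms(1) by (simp add: Pow_insert sum.union_disjoint sum.reindex)
qed

text \<open>Moebius inversion is an iterated first difference, one element at a time. This is the
  induction step of both inversion formulas below.\<close>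

lemma mobius_insert:
  assumes "finite S" "x \<notin> S"
  shows "mobius f (insert x S) = mobius (\<lambda>T. f (insert x T) - f T) S"
proof -
  have 1: "card (insert x S - T) = Suc (card (S - T))" if "T \<subseteq> S" for T
    using assms that by (metis card_insert_disjoint finite_Diff insert_Diff_if in_mono Diff_iff)
  have 2: "insert x S - insert x T = S - T" if "T \<subseteq> S" for T
    using assms that by auto
  have "(\<Sum>T\<in>Pow S. (-1) ^ card (insert x S - T) * f T) = (\<Sum>T\<in>Pow S. - ((-1) ^ card (S - T) * f T))"
    by (intro sum.cong) (auto simp: 1)
  moreover have "(\<Sum>T\<in>Pow S. (-1) ^ card (insert x S - insert x T) * f (insert x T))
      = (\<Sum>T\<in>Pow S. (-1) ^ card (S - T) * f (insert x T))"
    by (intro sum.cong refl) (simp only: 2 Pow_iff)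
  ultimately show ?thesis
    unfolding mobius_def sum_Pow_insert[OF assms]
    by (simp add: sum_negf right_diff_distrib sum_subtractf)
qed

lemma mobius_of_sum_Pow:
  assumes "finite S" "\<And>T. finite T \<Longrightarrow> f T = (\<Sum>A\<in>Pow T. g A)"
  shows "mobius f S = g S"
  using assms
proof (induction S arbitrary: f g rule: finite_induct)
  case empty
  then show ?case by (simp add: mobius_def)
next
  case (insert x S)
  have "mobius f (insert x S) = mobius (\<lambda>T. f (insert x T) - f T) S"
    by (rule mobius_insert) fact+
  \<comment> \<open>The difference is replaced by an explicit subset sum because the induction
    hypothesis wants that form for every finite \<open>T\<close>; the two agree only for
    \<open>T\<close> without \<open>x\<close>, which is all that \<open>mobius_cong\<close> asks
    for.\<close>
  also have "\<dots> = mobius (\<lambda>T. \<Sum>A\<in>Pow T. g (insert x A)) S"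
  proof (rule mobius_cong)
    fix T assume "T \<subseteq> S"
    then have "finite T" "x \<notin> T" using insert finite_subset by auto
    then show "f (insert x T) - f T = (\<Sum>A\<in>Pow T. g (insert x A))"
      by (simp add: insert.prems sum_Pow_insert)
  qed
  also have "\<dots> = g (insert x S)"
    by (rule insert.IH) simp
  finally show ?case .
qed

lemma sum_Pow_mobius:
  assumes "finite S"
  shows "(\<Sum>T\<in>Pow S. mobius f T) = f S"
  using assms
proof (induction S arbitrary: f rule: finite_induct)
  case empty
  then show ?case by (simp add: mobius_def)
next
  case (insert x S)
  have "(\<Sum>T\<in>Pow S. mobius f (insert x T)) = (\<Sum>T\<in>Pow S. mobius (\<lambda>T. f (insert x T) - f T) T)"
    using insert by (intro sum.cong refl mobius_insert) (auto intro: finite_subset)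
  then show ?case
    using insert by (simp add: sum_Pow_insert)
qed

text \<open>One element that \<open>f\<close> does not notice makes every first difference in its
  direction zero. The later use is a node too far from the root to influence a ball.\<close>

lemma mobius_eq_0:
  assumes "finite S" "u \<in> S" "\<And>T. T \<subseteq> S - {u} \<Longrightarrow> f (insert u T) = f T"
  shows "mobius f S = 0"
proof -
  have "mobius f (insert u (S - {u})) = mobius (\<lambda>T. f (insert u T) - f T) (S - {u})"
    by (rule mobius_insert) (use assms in auto)
  also have "\<dots> = mobius (\<lambda>T. 0) (S - {u})"
    by (rule mobius_cong) (use assms in auto)
  finally show ?thesis
    using assms(2) by (simp add: insert_absorb mobius_def)
qed

lemma mobius_image:
  assumes "inj_on h S" "\<And>T. T \<subseteq> S \<Longrightarrow> g (h ` T) = f T"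
  shows "mobius g (h ` S) = mobius f S"
proof -
  have "mobius g (h ` S) = (\<Sum>T\<in>image h ` Pow S. (-1) ^ card (h ` S - T) * g T)"
    unfolding mobius_def by (rule sum.cong) (auto simp: image_Pow_surj)
  also have "\<dots> = (\<Sum>T\<in>Pow S. (-1) ^ card (h ` S - h ` T) * g (h ` T))"
    by (subst sum.reindex) (auto simp: inj_on_image_Pow assms(1))
  also have "\<dots> = mobius f S"
    unfolding mobius_def
  proof (intro sum.cong refl)
    fix T assume "T \<in> Pow S"
    then have "h ` S - h ` T = h ` (S - T)" "inj_on h (S - T)"
      using assms(1) by (auto simp: inj_on_def)
    then show "(-1) ^ card (h ` S - h ` T) * g (h ` T) = (-1) ^ card (S - T) * f T"
      using \<open>T \<in> Pow S\<close> assms(2) by (simp add: card_image)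
  qed
  finally show ?thesis .
qed

text \<open>Subset sums are closed under products: the new density at \<open>S\<close> sums over all
  covers of \<open>S\<close> by two sets, which may overlap.\<close>

lemma sum_Pow_mult:
  fixes f g :: "'a set \<Rightarrow> 'b::comm_semiring_1"
  assumes "finite Y"
  shows "(\<Sum>A\<in>Pow Y. f A) * (\<Sum>B\<in>Pow Y. g B) =
    (\<Sum>S\<in>Pow Y. \<Sum>(A, B)\<in>{p \<in> Pow S \<times> Pow S. fst p \<union> snd p = S}. f A * g B)"
proof -
  have "(\<Sum>A\<in>Pow Y. f A) * (\<Sum>B\<in>Pow Y. g B) = (\<Sum>(A, B)\<in>Pow Y \<times> Pow Y. f A * g B)"
    by (simp add: sum_product sum.cartesian_product)
  also have "\<dots> = (\<Sum>S\<in>Pow Y. \<Sum>p\<in>{p \<in> Pow Y \<times> Pow Y. fst p \<union> snd p = S}. case p of (A, B) \<Rightarrow> f A * g B)"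
    by (rule sum.group[symmetric]) (use assms in auto)
  also have "\<dots> = (\<Sum>S\<in>Pow Y. \<Sum>(A, B)\<in>{p \<in> Pow S \<times> Pow S. fst p \<union> snd p = S}. f A * g B)"
    by (intro sum.cong) auto
  finally show ?thesis .
qed


section \<open>Homomorphisms into looped graphs\<close>

text \<open>
  A set \<open>Y\<close> of type \<^typ>\<open>('c + 'c set) set\<close> encodes the graph with nodes \<open>Inl -` Y\<close> and edges
  \<open>Inr -` Y\<close>, so that inclusion-exclusion over nodes and edges is a single Moebius inversion.
\<close>

definition edge_image :: "('a \<times> 'a) set \<Rightarrow> ('a \<Rightarrow> 'c) \<Rightarrow> 'a set \<Rightarrow> 'c set set" where
  "edge_image E \<phi> S = {{\<phi> x, \<phi> y} | x y. x \<in> S \<and> y \<in> S \<and> (x, y) \<in> E \<and> \<phi> x \<noteq> \<phi> y}"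

definition hom_image :: "('a \<times> 'a) set \<Rightarrow> ('a \<Rightarrow> 'c) \<Rightarrow> 'a set \<Rightarrow> ('c + 'c set) set" where
  "hom_image E \<phi> S = \<phi> ` S <+> edge_image E \<phi> S"

definition looped_homs :: "('a \<times> 'a) set \<Rightarrow> ('c + 'c set) set \<Rightarrow> 'a set \<Rightarrow> ('a \<Rightarrow> 'c) set" where
  "looped_homs E Y S = {\<phi> \<in> S \<rightarrow>\<^sub>E (Inl -` Y). hom_image E \<phi> S \<subseteq> Y}"

definition onto_homs :: "('a \<times> 'a) set \<Rightarrow> ('c + 'c set) set \<Rightarrow> 'a set \<Rightarrow> ('a \<Rightarrow> 'c) set" where
  "onto_homs E Y S = {\<phi> \<in> S \<rightarrow>\<^sub>E (Inl -` Y). hom_image E \<phi> S = Y}"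

lemma finite_Inl_vimage: "finite Y \<Longrightarrow> finite (Inl -` Y)"
  by (rule finite_vimageI) auto

text \<open>Every homomorphism into \<open>Y\<close> is onto exactly one subset of \<open>Y\<close>,
  namely its own image. So the onto counts are the Moebius density of the full count.\<close>

lemma card_looped_homs:
  fixes Y :: "('c + 'c set) set"
  assumes "finite S" "finite Y"
  shows "card (looped_homs E Y S) = (\<Sum>A\<in>Pow Y. card (onto_homs E A S))"
proof -
  have eq: "looped_homs E Y S = (\<Union>A\<in>Pow Y. onto_homs E A S)"
  proof (intro set_eqI iffI)
    fix \<phi> assume "\<phi> \<in> looped_homs E Y S"
    then have "\<phi> \<in> onto_homs E (hom_image E \<phi> S) S" "hom_image E \<phi> S \<in> Pow Y"
      unfolding looped_homs_def onto_homs_def by (auto simp: hom_image_def PiE_iff)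
    then show "\<phi> \<in> (\<Union>A\<in>Pow Y. onto_homs E A S)" by blast
  next
    fix \<phi> assume "\<phi> \<in> (\<Union>A\<in>Pow Y. onto_homs E A S)"
    then obtain A where "A \<subseteq> Y" "\<phi> \<in> onto_homs E A S" by blast
    then show "\<phi> \<in> looped_homs E Y S"
      unfolding looped_homs_def onto_homs_def by (auto simp: PiE_iff)
  qed
  have fin: "finite (onto_homs E A S)" if "A \<in> Pow Y" for A
  proof -
    have "finite (S \<rightarrow>\<^sub>E (Inl -` A :: 'c set))"
      using that assms by (intro finite_PiE finite_Inl_vimage) (auto intro: finite_subset)
    then show ?thesis unfolding onto_homs_def by simp
  qed
  have "onto_homs E A S \<inter> onto_homs E B S = {}" if "A \<noteq> B" for A B
    using that unfolding onto_homs_def by auto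
  then have disj: "\<forall>A\<in>Pow Y. \<forall>B\<in>Pow Y. A \<noteq> B \<longrightarrow> onto_homs E A S \<inter> onto_homs E B S = {}"
    by blast
  show ?thesis
    unfolding eq by (rule card_UN_disjoint[OF _ _ disj]) (use assms fin in blast)+
qed

text \<open>
  Membership in this class bounds the number of nodes, not of edges; every edge in the support lies
  between nodes in the support, which is what connectedness contradicts below.
\<close>

definition node_order_le :: "nat \<Rightarrow> (('c + 'c set) set \<Rightarrow> complex) \<Rightarrow> bool" where
  "node_order_le j f \<longleftrightarrow> (\<exists>g. (\<forall>Y. finite Y \<longrightarrow> f Y = (\<Sum>A\<in>Pow Y. g A)) \<and>
    (\<forall>Y. finite Y \<longrightarrow> g Y \<noteq> 0 \<longrightarrow> card (Inl -` Y) \<le> j \<and> \<Union>(Inr -` Y) \<subseteq> Inl -` Y))"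

lemma node_order_le_sum:
  assumes "\<And>i. i \<in> I \<Longrightarrow> node_order_le j (f i)"
  shows "node_order_le j (\<lambda>Y. \<Sum>i\<in>I. f i Y)"
proof -
  obtain g where g: "\<And>i Y. i \<in> I \<Longrightarrow> finite Y \<Longrightarrow> f i Y = (\<Sum>A\<in>Pow Y. g i A)"
    "\<And>i Y. i \<in> I \<Longrightarrow> finite Y \<Longrightarrow> g i Y \<noteq> 0 \<Longrightarrow> card (Inl -` Y) \<le> j \<and> \<Union>(Inr -` Y) \<subseteq> Inl -` Y"
    using assms unfolding node_order_le_def by metis
  show ?thesis
    unfolding node_order_le_def
  proof (intro exI conjI allI impI)
    fix Y :: "('b + 'b set) set"
    assume "finite Y"
    then show "(\<Sum>i\<in>I. f i Y) = (\<Sum>A\<in>Pow Y. \<Sum>i\<in>I. g i A)"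
      by (subst sum.swap) (simp add: g(1))
  next
    fix Y :: "('b + 'b set) set"
    assume "finite Y" "(\<Sum>i\<in>I. g i Y) \<noteq> 0"
    moreover from this(2) obtain i where "i \<in> I" "g i Y \<noteq> 0"
      by (metis sum.neutral)
    ultimately show "card (Inl -` Y) \<le> j" "\<Union>(Inr -` Y) \<subseteq> Inl -` Y"
      using g(2) by metis+
  qed
qed

lemma node_order_le_cmult:
  assumes "node_order_le j f"
  shows "node_order_le j (\<lambda>Y. c * f Y)"
proof -
  obtain g where g: "\<And>Y. finite Y \<Longrightarrow> f Y = (\<Sum>A\<in>Pow Y. g A)"
    "\<And>Y. finite Y \<Longrightarrow> g Y \<noteq> 0 \<Longrightarrow> card (Inl -` Y) \<le> j \<and> \<Union>(Inr -` Y) \<subseteq> Inl -` Y"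
    using assms unfolding node_order_le_def by metis
  show ?thesis
    unfolding node_order_le_def
    by (rule exI[of _ "\<lambda>Y. c * g Y"]) (use g in \<open>auto simp: sum_distrib_left\<close>)
qed

lemma node_order_le_diff:
  assumes "node_order_le j f" "node_order_le j g"
  shows "node_order_le j (\<lambda>Y. f Y - g Y)"
proof -
  have "node_order_le j (\<lambda>Y. \<Sum>b\<in>UNIV. if b then f Y else (-1) * g Y)"
  proof (rule node_order_le_sum)
    fix b
    show "node_order_le j (\<lambda>Y. if b then f Y else (-1) * g Y)"
      using assms(1) node_order_le_cmult[OF assms(2), of "-1"] by (cases b) auto
  qed
  then show ?thesis by (simp add: UNIV_bool)
qed

text \<open>The density of the product lives on unions of the two supports. Node numbers add up at
  most, and edges of a union still have both ends in it.\<close>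

lemma node_order_le_mult:
  assumes "node_order_le i f" "node_order_le j g"
  shows "node_order_le (i + j) (\<lambda>Y. f Y * g Y)"
proof -
  obtain f' where f': "\<And>Y. finite Y \<Longrightarrow> f Y = (\<Sum>A\<in>Pow Y. f' A)"
    "\<And>Y. finite Y \<Longrightarrow> f' Y \<noteq> 0 \<Longrightarrow> card (Inl -` Y) \<le> i \<and> \<Union>(Inr -` Y) \<subseteq> Inl -` Y"
    using assms(1) unfolding node_order_le_def by metis
  obtain g' where g': "\<And>Y. finite Y \<Longrightarrow> g Y = (\<Sum>A\<in>Pow Y. g' A)"
    "\<And>Y. finite Y \<Longrightarrow> g' Y \<noteq> 0 \<Longrightarrow> card (Inl -` Y) \<le> j \<and> \<Union>(Inr -` Y) \<subseteq> Inl -` Y"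
    using assms(2) unfolding node_order_le_def by metis
  define h where "h S = (\<Sum>(A, B)\<in>{p \<in> Pow S \<times> Pow S. fst p \<union> snd p = S}. f' A * g' B)" for S
  show ?thesis
    unfolding node_order_le_def
  proof (intro exI[of _ h] conjI allI impI)
    fix Y :: "('a + 'a set) set"
    assume "finite Y"
    then show "f Y * g Y = (\<Sum>A\<in>Pow Y. h A)"
      unfolding h_def by (simp add: f' g' sum_Pow_mult)
  next
    fix Y :: "('a + 'a set) set"
    assume Y: "finite Y" "h Y \<noteq> 0"
    then obtain A B where AB: "A \<union> B = Y" "f' A * g' B \<noteq> 0"
      unfolding h_def by (force dest!: sum.not_neutral_contains_not_neutral)
    with Y have fin: "finite A" "finite B" by auto
    have A: "card (Inl -` A) \<le> i" "\<Union>(Inr -` A) \<subseteq> Inl -` A"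
      using f'(2)[OF fin(1)] AB(2) by auto
    have B: "card (Inl -` B) \<le> j" "\<Union>(Inr -` B) \<subseteq> Inl -` B"
      using g'(2)[OF fin(2)] AB(2) by auto
    have eq: "Inl -` Y = Inl -` A \<union> Inl -` B" using AB(1) by auto
    show "card (Inl -` Y) \<le> i + j"
      unfolding eq using card_Un_le[of "Inl -` A" "Inl -` B"] A(1) B(1) by linarith
    show "\<Union>(Inr -` Y) \<subseteq> Inl -` Y"
      using A(2) B(2) unfolding AB(1)[symmetric] by blast
  qed
qed

text \<open>Connectedness is stated by cuts, not paths, since it is only used to find an edge across
  a given partition of the nodes.\<close>

definition connected_graph :: "'c set \<Rightarrow> 'c set set \<Rightarrow> bool" where
  "connected_graph W F \<longleftrightarrow>
    (\<forall>A \<subseteq> W. A \<noteq> {} \<longrightarrow> A \<noteq> W \<longrightarrow> (\<exists>x\<in>A. \<exists>y\<in>W - A. {x, y} \<in> F))"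

text \<open>The Moebius value is the density of the product at \<open>W <+> F\<close>, a sum over
  covers by two supports. The bounds \<open>i\<close> and \<open>j\<close> leave no slack, so the
  two node sets partition \<open>W\<close>. An edge of \<open>F\<close> across this partition would
  lie in one support without having both ends there.\<close>

lemma mobius_mult_connected_eq_0:
  assumes "node_order_le i f" "node_order_le j g" "i + j = card W" "i \<ge> 1" "j \<ge> 1"
    and "finite W" "finite F" "connected_graph W F"
  shows "mobius (\<lambda>Y. f Y * g Y) (W <+> F) = 0"
proof -
  obtain f' where f': "\<And>Y. finite Y \<Longrightarrow> f Y = (\<Sum>A\<in>Pow Y. f' A)"
    "\<And>Y. finite Y \<Longrightarrow> f' Y \<noteq> 0 \<Longrightarrow> card (Inl -` Y) \<le> i \<and> \<Union>(Inr -` Y) \<subseteq> Inl -` Y"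
    using assms(1) unfolding node_order_le_def by metis
  obtain g' where g': "\<And>Y. finite Y \<Longrightarrow> g Y = (\<Sum>A\<in>Pow Y. g' A)"
    "\<And>Y. finite Y \<Longrightarrow> g' Y \<noteq> 0 \<Longrightarrow> card (Inl -` Y) \<le> j \<and> \<Union>(Inr -` Y) \<subseteq> Inl -` Y"
    using assms(2) unfolding node_order_le_def by metis
  define h where "h S = (\<Sum>(A, B)\<in>{p \<in> Pow S \<times> Pow S. fst p \<union> snd p = S}. f' A * g' B)" for S
  have fin: "finite (W <+> F)" using assms by simp
  have "mobius (\<lambda>Y. f Y * g Y) (W <+> F) = h (W <+> F)"
    by (rule mobius_of_sum_Pow[OF fin]) (simp add: h_def f' g' sum_Pow_mult)
  moreover have "f' A * g' B = 0" if AB: "A \<union> B = W <+> F" for A B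
  proof (rule ccontr)
    assume nz: "f' A * g' B \<noteq> 0"
    have finAB: "finite A" "finite B" using fin AB by (metis finite_Un)+
    have A: "card (Inl -` A) \<le> i" "\<Union>(Inr -` A) \<subseteq> Inl -` A"
      using f'(2)[OF finAB(1)] nz by auto
    have B: "card (Inl -` B) \<le> j" "\<Union>(Inr -` B) \<subseteq> Inl -` B"
      using g'(2)[OF finAB(2)] nz by auto
    have eq: "Inl -` A \<union> Inl -` B = W" using AB by auto
    have finW: "finite (Inl -` A)" "finite (Inl -` B)"
      using finAB finite_Inl_vimage by auto
    have sum: "card (Inl -` A) + card (Inl -` B) = card W + card (Inl -` A \<inter> Inl -` B)"
      using card_Un_Int[OF finW] eq by simp
    \<comment> \<open>Both bounds are attained and the overlap is empty, because
      \<open>i + j\<close> is exactly the number of nodes to be covered.\<close>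
    have cards: "card (Inl -` A) = i" "card (Inl -` A \<inter> Inl -` B) = 0"
      using sum A(1) B(1) assms(3) by linarith+
    then have disj: "Inl -` A \<inter> Inl -` B = {}" using finW by simp
    have "Inl -` A \<noteq> {}" "Inl -` A \<noteq> W" "Inl -` A \<subseteq> W"
      using cards(1) assms(3-5) eq by auto
    then obtain x y where xy: "x \<in> Inl -` A" "y \<in> W - Inl -` A" "{x, y} \<in> F"
      using assms(8) unfolding connected_graph_def by metis
    then have "Inr {x, y} \<in> A \<union> B" using AB by auto
    then show False
    proof
      assume "Inr {x, y} \<in> A"
      then show False using A(2) xy(2) by auto
    next
      assume "Inr {x, y} \<in> B"
      then show False using B(2) xy(1) disj by auto
    qed
  qed
  ultimately show ?thesis
    by (auto simp: h_def intro!: sum.neutral)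
qed

text \<open>The density is the onto count. A nonzero value exhibits the whole of \<open>Y\<close> as
  the image of \<open>S\<close>, which has at most \<open>card S\<close> nodes and contains the ends
  of its edges.\<close>

lemma node_order_le_looped_homs:
  assumes "finite S"
  shows "node_order_le (card S) (\<lambda>Y :: ('c + 'c set) set. of_nat (card (looped_homs E Y S)))"
  unfolding node_order_le_def
proof (intro exI conjI allI impI)
  fix Y :: "('c + 'c set) set"
  assume "finite Y"
  then show "of_nat (card (looped_homs E Y S)) = (\<Sum>A\<in>Pow Y. of_nat (card (onto_homs E A S)))"
    using assms by (simp add: card_looped_homs)
next
  fix Y :: "('c + 'c set) set"
  assume "finite Y" "(of_nat (card (onto_homs E Y S)) :: complex) \<noteq> 0"
  then have "onto_homs E Y S \<noteq> {}" by auto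
  then obtain \<phi> where "hom_image E \<phi> S = Y"
    unfolding onto_homs_def by blast
  then have *: "Inl -` Y = \<phi> ` S" "Inr -` Y = edge_image E \<phi> S"
    unfolding hom_image_def by auto
  show "card (Inl -` Y) \<le> card S" "\<Union>(Inr -` Y) \<subseteq> Inl -` Y"
    unfolding * using assms by (auto simp: card_image_le edge_image_def)
qed

section \<open>The partition function as a formal power series and its logarithmic
  derivative\<close>

definition hom_series :: "('a \<times> 'a) set \<Rightarrow> 'a set \<Rightarrow> ('c + 'c set) set \<Rightarrow> complex fps" where
  "hom_series E V Y =
    Abs_fps (\<lambda>j. \<Sum>S | S \<subseteq> V \<and> card S = j. of_nat (card (looped_homs E Y S)))"

lemma hom_series_0: "finite V \<Longrightarrow> fps_nth (hom_series E V Y) 0 = 1"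
proof -
  assume "finite V"
  then have "{S. S \<subseteq> V \<and> card S = 0} = {{}}" by (auto dest: finite_subset)
  then show ?thesis
    by (simp add: hom_series_def looped_homs_def hom_image_def edge_image_def Plus_def)
qed

lemma node_order_le_hom_series:
  assumes "finite V"
  shows "node_order_le j (\<lambda>Y. fps_nth (hom_series E V Y) j)"
  unfolding hom_series_def fps_nth_Abs_fps
proof (rule node_order_le_sum)
  fix S assume "S \<in> {S. S \<subseteq> V \<and> card S = j}"
  then show "node_order_le j (\<lambda>Y. of_nat (card (looped_homs E Y S)))"
    using node_order_le_looped_homs[of S E] assms by (auto dest: finite_subset)
qed

text \<open>Z'/Z needs no formal logarithm. Its coefficient \<open>n\<close> is \<open>n + 1\<close>
  times coefficient \<open>n + 1\<close> of ln Z, so index \<open>n\<close> belongs to connected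
  graphs with \<open>Suc n\<close> nodes.\<close>

definition log_deriv_series :: "('a \<times> 'a) set \<Rightarrow> 'a set \<Rightarrow> ('c + 'c set) set \<Rightarrow> complex fps" where
  "log_deriv_series E V Y = fps_deriv (hom_series E V Y) * inverse (hom_series E V Y)"

text \<open>Newton's identities: compare coefficients in (Z'/Z) Z = Z', where Z has constant
  coefficient 1.\<close>

lemma log_deriv_series_rec:
  assumes "finite V"
  shows "fps_nth (log_deriv_series E V Y) n = of_nat (Suc n) * fps_nth (hom_series E V Y) (Suc n)
    - (\<Sum>i<n. fps_nth (log_deriv_series E V Y) i * fps_nth (hom_series E V Y) (n - i))"
proof -
  have "log_deriv_series E V Y * hom_series E V Y = fps_deriv (hom_series E V Y)"
    unfolding log_deriv_series_def
    by (simp add: mult.assoc inverse_mult_eq_1 hom_series_0 assms)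
  then have "fps_nth (log_deriv_series E V Y * hom_series E V Y) n = of_nat (Suc n) * fps_nth (hom_series E V Y) (Suc n)"
    by simp
  moreover have "fps_nth (log_deriv_series E V Y * hom_series E V Y) n =
    (\<Sum>i<n. fps_nth (log_deriv_series E V Y) i * fps_nth (hom_series E V Y) (n - i)) +
    fps_nth (log_deriv_series E V Y) n"
    unfolding fps_mult_nth atLeast0AtMost
    by (simp add: lessThan_Suc_atMost[symmetric] hom_series_0 assms)
  ultimately show ?thesis by (simp add: algebra_simps)
qed

text \<open>By the recursion: factor \<open>i\<close> has order \<open>Suc i\<close>, the other
  factor has order \<open>n - i\<close>, and these add up to \<open>Suc n\<close>.\<close>

lemma node_order_le_log_deriv_series:
  assumes "finite V"
  shows "node_order_le (Suc n) (\<lambda>Y :: ('c + 'c set) set. fps_nth (log_deriv_series E V Y) n)"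
proof (induction n rule: less_induct)
  case (less n)
  show ?case
    unfolding log_deriv_series_rec[OF assms, of _ _ n]
  proof (intro node_order_le_diff node_order_le_cmult node_order_le_sum)
    show "node_order_le (Suc n) (\<lambda>Y :: ('c + 'c set) set. fps_nth (hom_series E V Y) (Suc n))"
      by (rule node_order_le_hom_series[OF assms])
  next
    fix i assume "i \<in> {..<n}"
    then show "node_order_le (Suc n)
        (\<lambda>Y :: ('c + 'c set) set. fps_nth (log_deriv_series E V Y) i * fps_nth (hom_series E V Y) (n - i))"
      using node_order_le_mult[OF less node_order_le_hom_series[OF assms], of i "n - i" E] by simp
  qed
qed

text \<open>
  In the recursion for the logarithmic derivative, every product term splits the nodes into two parts
  without an edge between them, so inclusion-exclusion at a connected graph annihilates all of them.
\<close>

lemma mobius_log_deriv_series: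
  assumes "finite V" "finite W" "finite F" "connected_graph W F" "card W = Suc n"
  shows "mobius (\<lambda>Y. fps_nth (log_deriv_series E V Y) n) (W <+> F) =
    of_nat (Suc n) * (\<Sum>S | S \<subseteq> V \<and> card S = Suc n. of_nat (card (onto_homs E (W <+> F) S)))"
proof -
  have "mobius (\<lambda>Y. fps_nth (log_deriv_series E V Y) i * fps_nth (hom_series E V Y) (n - i)) (W <+> F) = 0"
    if "i < n" for i
    by (rule mobius_mult_connected_eq_0[OF node_order_le_log_deriv_series[OF assms(1)]
          node_order_le_hom_series[OF assms(1)]]) (use assms that in auto)
  then have "mobius (\<lambda>Y. fps_nth (log_deriv_series E V Y) n) (W <+> F) =
      of_nat (Suc n) * mobius (\<lambda>Y. fps_nth (hom_series E V Y) (Suc n)) (W <+> F)"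
    unfolding log_deriv_series_rec[OF assms(1), of _ _ n]
    by (simp only: mobius_diff mobius_sum mobius_cmult) simp
  also have "mobius (\<lambda>Y. fps_nth (hom_series E V Y) (Suc n)) (W <+> F) =
      (\<Sum>S | S \<subseteq> V \<and> card S = Suc n. of_nat (card (onto_homs E (W <+> F) S)))"
    unfolding hom_series_def fps_nth_Abs_fps mobius_sum
  proof (intro sum.cong refl mobius_of_sum_Pow)
    fix S and Y :: "('b + 'b set) set"
    assume "S \<in> {S. S \<subseteq> V \<and> card S = Suc n}" "finite Y"
    then show "of_nat (card (looped_homs E Y S)) = (\<Sum>A\<in>Pow Y. of_nat (card (onto_homs E A S)))"
      using assms(1) finite_subset[of S V] by (simp add: card_looped_homs)
  qed (use assms in auto)
  finally show ?thesis .
qed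

section \<open>Independence polynomials near zero\<close>

definition indep :: "('x \<times> 'x) set \<Rightarrow> 'x set \<Rightarrow> bool" where
  "indep C A \<longleftrightarrow> (\<forall>a\<in>A. \<forall>b\<in>A. a \<noteq> b \<longrightarrow> (a, b) \<notin> C)"

lemma indep_insert:
  assumes "sym C" "x \<notin> A"
  shows "indep C (insert x A) \<longleftrightarrow> indep C A \<and> A \<inter> C `` {x} = {}"
proof
  assume "indep C (insert x A)"
  then show "indep C A \<and> A \<inter> C `` {x} = {}"
    using assms(2) unfolding indep_def by auto
next
  assume A: "indep C A \<and> A \<inter> C `` {x} = {}"
  then have "(x, a) \<notin> C" "(a, x) \<notin> C" if "a \<in> A" for a
    using that assms(1) by (auto dest: symD)
  then show "indep C (insert x A)"
    using A unfolding indep_def by (metis insert_iff)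
qed

definition indep_poly :: "('x \<times> 'x) set \<Rightarrow> 'x set \<Rightarrow> 'b::comm_semiring_1 \<Rightarrow> 'b" where
  "indep_poly C X z = (\<Sum>A | A \<subseteq> X \<and> indep C A. z ^ card A)"

text \<open>Independent sets without \<open>x\<close> give the first term. Those with
  \<open>x\<close> avoid its neighbours and lose one factor \<open>z\<close> when \<open>x\<close>
  is removed.\<close>

lemma indep_poly_insert:
  assumes "finite X" "x \<notin> X" "sym C"
  shows "indep_poly C (insert x X) z = indep_poly C X z + z * indep_poly C (X - C `` {x}) z"
proof -
  let ?P = "{A. A \<subseteq> X \<and> indep C A}"
  let ?Q = "{A. A \<subseteq> X - C `` {x} \<and> indep C A}"
  have eq: "{A. A \<subseteq> insert x X \<and> indep C A} = ?P \<union> insert x ` ?Q"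
  proof (intro set_eqI iffI)
    fix A assume A: "A \<in> {A. A \<subseteq> insert x X \<and> indep C A}"
    show "A \<in> ?P \<union> insert x ` ?Q"
    proof (cases "x \<in> A")
      case True
      then have eq: "A = insert x (A - {x})" by blast
      then have "indep C (insert x (A - {x}))" using A by simp
      then have "indep C (A - {x})" "(A - {x}) \<inter> C `` {x} = {}"
        using indep_insert[OF assms(3), of x "A - {x}"] by blast+
      then have "A - {x} \<in> ?Q" using A by blast
      then show ?thesis using eq by blast
    next
      case False
      then show ?thesis using A by blast
    qed
  next
    fix A assume "A \<in> ?P \<union> insert x ` ?Q"
    then consider "A \<in> ?P" | B where "A = insert x B" "B \<in> ?Q" by blast
    then show "A \<in> {A. A \<subseteq> insert x X \<and> indep C A}"
    proof cases
      case 2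
      then have "x \<notin> B" "B \<inter> C `` {x} = {}" using assms(2) by blast+
      then show ?thesis using 2 indep_insert[OF assms(3), of x B] by blast
    qed blast
  qed
  have inj: "inj_on (insert x) ?Q"
  proof (rule inj_onI)
    fix A B assume "A \<in> ?Q" "B \<in> ?Q" "insert x A = insert x B"
    moreover from this have "x \<notin> A" "x \<notin> B" using assms(2) by blast+
    ultimately show "A = B" using insert_ident by metis
  qed
  have disj: "?P \<inter> insert x ` ?Q = {}"
    using assms(2) by blast
  have fin: "finite ?P" "finite ?Q"
    using assms(1) by auto
  have "indep_poly C (insert x X) z = indep_poly C X z + (\<Sum>A\<in>?Q. z ^ card (insert x A))"
    unfolding indep_poly_def eq using fin disj inj by (simp add: sum.union_disjoint sum.reindex)
  also have "(\<Sum>A\<in>?Q. z ^ card (insert x A)) = (\<Sum>A\<in>?Q. z * z ^ card A)"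
  proof (intro sum.cong refl)
    fix A assume "A \<in> ?Q"
    then have "finite A" "x \<notin> A" using assms finite_subset by blast+
    then show "z ^ card (insert x A) = z * z ^ card A" by simp
  qed
  finally show ?thesis
    by (simp add: indep_poly_def sum_distrib_left)
qed

lemma indep_poly_empty: "indep_poly C {} z = 1"
proof -
  have "{A. A \<subseteq> {} \<and> indep C A} = {{}}" by (auto simp: indep_def)
  then show ?thesis unfolding indep_poly_def by simp
qed

lemma indep_poly_of_real: "indep_poly C X (of_real x) = complex_of_real (indep_poly C X x)"
  unfolding indep_poly_def by simp

lemma indep_poly_ge_1:
  fixes x :: real and X :: "'x set"
  assumes "finite X" "x \<ge> 0"
  shows "indep_poly C X x \<ge> 1"
proof -
  let ?P = "{A. A \<subseteq> X \<and> indep C A}"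
  have "(\<Sum>A\<in>{{} :: 'x set}. x ^ card A) \<le> (\<Sum>A\<in>?P. x ^ card A)"
    by (rule sum_mono2) (use assms in \<open>auto simp: indep_def\<close>)
  then show ?thesis unfolding indep_poly_def by simp
qed

lemma indep_poly_holomorphic: "indep_poly C X holomorphic_on S"
proof -
  have "(\<lambda>z. \<Sum>A | A \<subseteq> X \<and> indep C A. z ^ card A) holomorphic_on S"
    by (intro holomorphic_on_sum holomorphic_on_power holomorphic_on_ident)
  then show ?thesis by (simp add: indep_poly_def[abs_def])
qed

text \<open>The ratio bound is what makes zero-freeness inductive. In I(X) = I(X - x) + z I(X - x -
  N(x)) the last polynomial is at most \<open>2 ^ \<Delta>\<close> times I(X - x) in norm, by
  induction, as at most \<open>\<Delta>\<close> nodes are removed. The bound on \<open>z\<close>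
  then makes the correction at most half of I(X - x), so deleting one node costs a factor of at most
  2.\<close>

lemma indep_poly_zero_free:
  fixes z :: complex
  assumes "finite X" "sym C" "\<And>x. card (C `` {x}) \<le> \<Delta>" "\<And>x. finite (C `` {x})"
    and z: "norm z * 2 ^ (\<Delta> + 1) \<le> 1"
  shows "indep_poly C X z \<noteq> 0 \<and>
    (\<forall>Y\<subseteq>X. norm (indep_poly C Y z) \<le> 2 ^ card (X - Y) * norm (indep_poly C X z))"
  using assms(1)
proof (induction X rule: finite_psubset_induct)
  case (psubset X)
  let ?I = "\<lambda>X. indep_poly C X z"
  have step: "?I X \<noteq> 0 \<and> norm (?I (X - {x})) \<le> 2 * norm (?I X)" if "x \<in> X" for x
  proof -
    let ?X = "X - {x}"
    have IH: "?I ?X \<noteq> 0" "\<And>Y. Y \<subseteq> ?X \<Longrightarrow> norm (?I Y) \<le> 2 ^ card (?X - Y) * norm (?I ?X)"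
      using psubset.IH[of ?X] that by auto
    have "?I (insert x ?X) = ?I ?X + z * ?I (?X - C `` {x})"
      by (rule indep_poly_insert) (use psubset.hyps assms in auto)
    then have eq: "?I X = ?I ?X + z * ?I (?X - C `` {x})"
      using that by (simp add: insert_absorb)
    have "card (?X - (?X - C `` {x})) \<le> card (C `` {x})"
      by (rule card_mono) (use assms in auto)
    then have "card (?X - (?X - C `` {x})) \<le> \<Delta>" using assms(3) le_trans by blast
    then have "(2::real) ^ card (?X - (?X - C `` {x})) \<le> 2 ^ \<Delta>"
      by (rule power_increasing) simp
    then have "norm (?I (?X - C `` {x})) \<le> 2 ^ \<Delta> * norm (?I ?X)"
      using IH(2)[of "?X - C `` {x}"] by (meson Diff_subset mult_right_mono norm_ge_zero order_trans)
    then have "norm (z * ?I (?X - C `` {x})) \<le> norm z * (2 ^ \<Delta> * norm (?I ?X))"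
      unfolding norm_mult by (rule mult_left_mono) simp
    also have "\<dots> = (norm z * 2 ^ (\<Delta> + 1)) * (norm (?I ?X) / 2)" by simp
    also have "\<dots> \<le> 1 * (norm (?I ?X) / 2)" by (rule mult_right_mono[OF z]) simp
    finally have "norm (?I X) \<ge> norm (?I ?X) - norm (?I ?X) / 2"
      unfolding eq using norm_diff_ineq[of "?I ?X" "z * ?I (?X - C `` {x})"] by linarith
    then show ?thesis using IH(1) by auto
  qed
  show ?case
  proof (cases "X = {}")
    case True
    then show ?thesis by (simp add: indep_poly_empty)
  next
    case False
    have "norm (?I Y) \<le> 2 ^ card (X - Y) * norm (?I X)" if Y: "Y \<subseteq> X" for Y
    proof (cases "Y = X")
      case False
      then obtain x where x: "x \<in> X" "x \<notin> Y" using Y by auto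
      have "norm (?I Y) \<le> 2 ^ card (X - {x} - Y) * norm (?I (X - {x}))"
        using psubset.IH[of "X - {x}"] x Y by auto
      also have "\<dots> \<le> 2 ^ card (X - {x} - Y) * (2 * norm (?I X))"
        using step[OF x(1)] by simp
      also have "\<dots> = 2 ^ card (X - Y) * norm (?I X)"
      proof -
        have "X - Y = insert x (X - {x} - Y)" using x by auto
        then have "card (X - Y) = Suc (card (X - {x} - Y))"
          using psubset.hyps by (metis card_insert_disjoint finite_Diff insertI1 Diff_iff)
        then show ?thesis by simp
      qed
      finally show ?thesis .
    qed simp
    then show ?thesis using False step by blast
  qed
qed

text \<open>The logarithm is assembled node by node, without choosing a branch globally. Inserting
  \<open>x\<close> multiplies the polynomial by \<open>1 + w\<close>, and the exponent
  \<open>\<Delta> + 2\<close> gives \<open>norm (w z) \<le> 1/4\<close>. So \<open>1 + w z\<close>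
  avoids the cut of \<open>Ln\<close>, and each node adds at most 1 to the norm of the logarithm. At
  nonnegative reals \<open>w\<close> is real and nonnegative, which keeps the values equal to the
  real logarithm.\<close>

lemma indep_poly_log:
  fixes R :: real
  assumes "finite X" "sym C" "\<And>x. card (C `` {x}) \<le> \<Delta>" "\<And>x. finite (C `` {x})"
    and R: "R * 2 ^ (\<Delta> + 2) \<le> 1"
  shows "\<exists>L. L holomorphic_on ball 0 R \<and>
    (\<forall>z\<in>ball 0 R. exp (L z) = indep_poly C X z \<and> norm (L z) \<le> card X) \<and>
    (\<forall>x. 0 \<le> x \<longrightarrow> x < R \<longrightarrow> L (complex_of_real x) = of_real (ln (indep_poly C X x)))"
  using assms(1)
proof (induction X rule: finite_induct)
  case empty
  show ?case by (rule exI[of _ "\<lambda>_. 0"]) (simp add: indep_poly_empty)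
next
  case (insert x X)
  then obtain L where L: "L holomorphic_on ball 0 R"
    "\<And>z. z \<in> ball 0 R \<Longrightarrow> exp (L z) = indep_poly C X z"
    "\<And>z. z \<in> ball 0 R \<Longrightarrow> norm (L z) \<le> card X"
    "\<And>x. 0 \<le> x \<Longrightarrow> x < R \<Longrightarrow> L (complex_of_real x) = of_real (ln (indep_poly C X x))"
    by auto
  define w where "w z = z * indep_poly C (X - C `` {x}) z / indep_poly C X z" for z :: complex
  have zf: "indep_poly C X z \<noteq> 0" "norm (w z) \<le> 1/4" if "z \<in> ball 0 R" for z
  proof -
    have z: "norm z * 2 ^ (\<Delta> + 2) \<le> 1"
    proof -
      have "norm z * 2 ^ (\<Delta> + 2) \<le> R * 2 ^ (\<Delta> + 2)"
        using that by (intro mult_right_mono) auto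
      then show ?thesis using R by linarith
    qed
    then have "norm z * 2 ^ (\<Delta> + 1) \<le> 1" by simp
    from indep_poly_zero_free[OF insert.hyps(1) assms(2-4) this]
    have *: "indep_poly C X z \<noteq> 0" "norm (indep_poly C (X - C `` {x}) z) \<le>
      2 ^ card (X - (X - C `` {x})) * norm (indep_poly C X z)" by auto
    have "card (X - (X - C `` {x})) \<le> card (C `` {x})"
      by (rule card_mono) (use assms in auto)
    then have "card (X - (X - C `` {x})) \<le> \<Delta>" using assms(3) le_trans by blast
    then have "(2::real) ^ card (X - (X - C `` {x})) \<le> 2 ^ \<Delta>"
      by (rule power_increasing) simp
    then have "norm (indep_poly C (X - C `` {x}) z) \<le> 2 ^ \<Delta> * norm (indep_poly C X z)"
      using *(2) by (meson mult_right_mono norm_ge_zero order_trans)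
    then have "norm (indep_poly C (X - C `` {x}) z) / norm (indep_poly C X z) \<le> 2 ^ \<Delta>"
      using *(1) by (simp add: divide_le_eq)
    then have "norm (w z) \<le> norm z * 2 ^ \<Delta>"
      unfolding w_def norm_divide norm_mult times_divide_eq_right[symmetric]
      by (intro mult_left_mono) auto
    also have "\<dots> \<le> 1/4" using z by simp
    finally show "norm (w z) \<le> 1/4" .
    show "indep_poly C X z \<noteq> 0" by fact
  qed
  have prod: "indep_poly C (insert x X) z = indep_poly C X z * (1 + w z)" if "z \<in> ball 0 R" for z
    using zf(1)[OF that] insert assms(2) by (simp add: w_def indep_poly_insert field_simps)
  have nz: "1 + w z \<noteq> 0" "1 + w z \<notin> \<real>\<^sub>\<le>\<^sub>0" if "z \<in> ball 0 R" for z
  proof -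
    have "\<bar>Re (w z)\<bar> \<le> 1/4" using zf(2)[OF that] abs_Re_le_cmod[of "w z"] by linarith
    then have "Re (1 + w z) > 0" by auto
    then show "1 + w z \<notin> \<real>\<^sub>\<le>\<^sub>0" by (auto simp: complex_nonpos_Reals_iff)
    then show "1 + w z \<noteq> 0" by (metis nonpos_Reals_zero_I)
  qed
  show ?case
  proof (intro exI[of _ "\<lambda>z. L z + Ln (1 + w z)"] conjI ballI allI impI)
    have "w holomorphic_on ball 0 R"
      unfolding w_def using zf(1) by (intro holomorphic_intros indep_poly_holomorphic) auto
    then show "(\<lambda>z. L z + Ln (1 + w z)) holomorphic_on ball 0 R"
      using nz by (intro holomorphic_intros L(1)) auto
  next
    fix z :: complex assume z: "z \<in> ball 0 R"
    show "exp (L z + Ln (1 + w z)) = indep_poly C (insert x X) z"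
      unfolding exp_add exp_Ln[OF nz(1)[OF z]] L(2)[OF z] prod[OF z] ..
    have "norm (Ln (1 + w z)) \<le> 2 * norm (w z)"
      by (rule norm_Ln_le) (use zf(2)[OF z] in linarith)
    then have "norm (Ln (1 + w z)) \<le> 1" using zf(2)[OF z] by linarith
    then show "norm (L z + Ln (1 + w z)) \<le> card (insert x X)"
      using L(3)[OF z] norm_triangle_ineq[of "L z" "Ln (1 + w z)"] insert.hyps by simp
  next
    fix t :: real assume t: "0 \<le> t" "t < R"
    let ?w = "t * indep_poly C (X - C `` {x}) t / indep_poly C X t"
    have w: "w (of_real t) = of_real ?w"
      unfolding w_def indep_poly_of_real by simp
    have pos: "indep_poly C X t > 0" "indep_poly C (X - C `` {x}) t > 0"
      using indep_poly_ge_1[of X t C] indep_poly_ge_1[of "X - C `` {x}" t C] insert.hyps t by auto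
    then have w0: "?w \<ge> 0" using t by simp
    have "Ln (1 + w (of_real t)) = of_real (ln (1 + ?w))"
      unfolding w using w0 Ln_of_real[of "1 + ?w"] by simp
    moreover have "indep_poly C (insert x X) t = indep_poly C X t * (1 + ?w)"
      using insert assms(2) pos by (simp add: indep_poly_insert field_simps)
    moreover have "ln (indep_poly C X t * (1 + ?w)) = ln (indep_poly C X t) + ln (1 + ?w)"
      using pos(1) w0 by (intro ln_mult_pos) auto
    ultimately show "L (of_real t) + Ln (1 + w (of_real t)) = of_real (ln (indep_poly C (insert x X) t))"
      using L(4)[OF t] by simp
  qed
qed

section \<open>Taylor coefficients recovered from values at points tending to 0\<close>

lemma taylor_remainder_bound:
  assumes "f holomorphic_on ball 0 R" "\<And>z. z \<in> ball 0 R \<Longrightarrow> norm (f z) \<le> B" "R > 0"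
    and z: "norm z \<le> R / 4"
  shows "norm (f z - (\<Sum>j<n. (deriv ^^ j) f 0 / fact j * z ^ j)) \<le> 2 * B * (2 / R * norm z) ^ n"
proof -
  define a where "a j = (deriv ^^ j) f 0 / fact j" for j
  define q where "q = 2 / R * norm z"
  have q: "0 \<le> q" "q \<le> 1/2" using z assms(3) by (auto simp: q_def field_simps)
  have B: "B \<ge> 0" using assms(2)[of 0] assms(3) by (metis centre_in_ball norm_ge_zero order_trans)
  have sub: "cball (0::complex) (R / 2) \<subseteq> ball 0 R" using assms(3) by auto
  \<comment> \<open>Cauchy's inequality on the circle of radius \<open>R / 2\<close>, which stays
    inside the open disc. Since \<open>norm z \<le> R / 4\<close>, the ratio \<open>q\<close> is at
    most 1/2, so the tail of the series is at most twice its leading bound.\<close>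
  have a: "norm (a j * z ^ j) \<le> B * q ^ j" for j
  proof -
    have "norm ((deriv ^^ j) f 0) \<le> fact j * B / (R / 2) ^ j"
    proof (rule Cauchy_inequality)
      show "f holomorphic_on ball 0 (R / 2)"
        using assms(1) by (rule holomorphic_on_subset) (use assms(3) in auto)
      show "continuous_on (cball 0 (R / 2)) f"
        using assms(1) sub holomorphic_on_imp_continuous_on holomorphic_on_subset by blast
      show "norm (f x) \<le> B" if "norm (0 - x) = R / 2" for x
        using that assms(3) by (intro assms(2)) auto
    qed (use assms in auto)
    then have "norm (a j) \<le> B / (R / 2) ^ j"
      unfolding a_def by (simp add: norm_divide field_simps)
    then have "norm (a j) * norm z ^ j \<le> B / (R / 2) ^ j * norm z ^ j"
      by (rule mult_right_mono) simp
    also have "\<dots> = B * q ^ j"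
      unfolding q_def using assms(3) by (simp add: field_simps power_mult_distrib power_divide)
    finally show ?thesis by (simp add: norm_mult norm_power)
  qed
  have "(\<lambda>j. a j * z ^ j) sums f z"
    using holomorphic_power_series[OF assms(1), of z] z assms(3) by (simp add: a_def)
  then have sums: "(\<lambda>j. a (j + n) * z ^ (j + n)) sums (f z - (\<Sum>j<n. a j * z ^ j))"
    by (rule sums_split_initial_segment)
  have geo: "(\<lambda>j. B * q ^ n * q ^ j) sums (B * q ^ n * (1 / (1 - q)))"
    using q by (intro sums_mult geometric_sums) auto
  have "norm (f z - (\<Sum>j<n. a j * z ^ j)) \<le> B * q ^ n * (1 / (1 - q))"
  proof -
    have "norm (\<Sum>j. a (j + n) * z ^ (j + n)) \<le> (\<Sum>j. B * q ^ n * q ^ j)"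
    proof (rule norm_suminf_le)
      show "norm (a (j + n) * z ^ (j + n)) \<le> B * q ^ n * q ^ j" for j
        using a[of "j + n"] by (simp add: power_add mult_ac)
    qed (use geo in \<open>rule sums_summable\<close>)
    then show ?thesis using sums_unique[OF sums] sums_unique[OF geo] by simp
  qed
  also have "\<dots> \<le> B * q ^ n * 2"
    using q B by (intro mult_left_mono) (auto simp: field_simps)
  finally show ?thesis unfolding a_def q_def by (simp add: mult_ac)
qed

text \<open>A uniform limit of convergent sequences is Cauchy. The approximating sequence may depend
  on \<open>e\<close>, so no limit has to be identified.\<close>

lemma convergent_if_approximable:
  fixes x :: "nat \<Rightarrow> complex"
  assumes "\<And>e. e > 0 \<Longrightarrow> \<exists>g. convergent g \<and> (\<forall>n. norm (x n - g n) \<le> e)"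
  shows "convergent x"
proof -
  have "Cauchy x"
  proof (rule CauchyI)
    fix e :: real assume "e > 0"
    then obtain g where g: "convergent g" "\<And>n. norm (x n - g n) \<le> e / 4"
      using assms[of "e / 4"] by auto
    have "Cauchy g" using g(1) by (rule convergent_Cauchy)
    then obtain M where M: "\<And>m n. m \<ge> M \<Longrightarrow> n \<ge> M \<Longrightarrow> norm (g m - g n) < e / 4"
      using \<open>e > 0\<close> CauchyD[of g "e / 4"] by auto
    have "norm (x m - x n) < e" if "m \<ge> M" "n \<ge> M" for m n
    proof -
      have "x m - x n = (x m - g m) + (g m - g n) - (x n - g n)" by simp
      then have "norm (x m - x n) \<le> norm (x m - g m) + norm (g m - g n) + norm (x n - g n)"
        by (metis norm_triangle_ineq norm_triangle_ineq4 add_right_mono order_trans)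
      then show ?thesis using g(2)[of m] g(2)[of n] M[OF that] \<open>e > 0\<close> by linarith
    qed
    then show "\<exists>M. \<forall>m\<ge>M. \<forall>n\<ge>M. norm (x m - x n) < e" by blast
  qed
  then show ?thesis by (simp add: Cauchy_convergent_iff)
qed

text \<open>Coefficient \<open>j\<close> is nearly the value at a small point \<open>z\<close> minus
  the lower Taylor terms, divided by \<open>z ^ j\<close>. The lower coefficients converge by
  induction, the values by assumption, and the error is O(|z|) uniformly in
  \<open>n\<close>.\<close>

lemma taylor_coeffs_convergent:
  fixes f :: "nat \<Rightarrow> complex \<Rightarrow> complex"
  assumes hol: "\<And>n. f n holomorphic_on ball 0 R" and R: "R > 0"
    and bound: "\<And>n z. z \<in> ball 0 R \<Longrightarrow> norm (f n z) \<le> B"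
    and conv: "\<And>k. k \<ge> k0 \<Longrightarrow> convergent (\<lambda>n. f n (1 / of_nat k))"
  shows "convergent (\<lambda>n. (deriv ^^ j) (f n) 0 / fact j)"
proof (induction j rule: less_induct)
  case (less j)
  define a where "a n i = (deriv ^^ i) (f n) 0 / fact i" for n i
  \<comment> \<open>The remainder after degree \<open>j\<close> is at most
    \<open>K * norm z ^ Suc j\<close>, so division by \<open>z ^ j\<close> leaves an error of
    \<open>K * norm z\<close>.\<close>
  define K where "K = 2 * B * (2 / R) ^ Suc j"
  show ?case
  proof (rule convergent_if_approximable)
    fix e :: real assume e: "e > 0"
    have lim: "(\<lambda>k. K * (1 / of_nat k)) \<longlonglongrightarrow> K * 0"
      by (intro tendsto_mult tendsto_const lim_1_over_n)
    have "\<forall>\<^sub>F k in sequentially. K * (1 / of_nat k) < e"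
      using lim e by (intro order_tendstoD(2)[OF lim]) auto
    moreover have "\<forall>\<^sub>F k in sequentially. 1 / of_nat k < R / 4"
      using R by (intro order_tendstoD(2)[OF lim_1_over_n]) auto
    moreover have "\<forall>\<^sub>F k in sequentially. k \<ge> max k0 1"
      by (rule eventually_ge_at_top)
    ultimately have "\<forall>\<^sub>F k in sequentially. K * (1 / of_nat k) < e \<and> 1 / of_nat k < R / 4 \<and> k \<ge> max k0 1"
      by eventually_elim auto
    then obtain k :: nat where k: "K * (1 / of_nat k) < e" "1 / of_nat k < R / 4" "k \<ge> k0" "k \<ge> 1"
      by (auto dest!: eventually_happens)
    define z :: complex where "z = 1 / of_nat k"
    have z: "norm z = 1 / of_nat k" "z \<noteq> 0" using k by (auto simp: z_def norm_divide)
    define g where "g n = (f n z - (\<Sum>i<j. a n i * z ^ i)) / z ^ j" for n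
    have "convergent g"
    proof -
      have "convergent (\<lambda>n. (f n z - (\<Sum>i<j. a n i * z ^ i)) * inverse (z ^ j))"
        using conv[OF k(3)] less
        by (intro convergent_mult convergent_diff convergent_sum convergent_const) (auto simp: a_def z_def)
      then show ?thesis unfolding g_def by (simp add: field_simps)
    qed
    moreover have "norm (a n j - g n) \<le> e" for n
    proof -
      have "norm (f n z - (\<Sum>i<Suc j. a n i * z ^ i)) \<le> 2 * B * (2 / R * norm z) ^ Suc j"
        unfolding a_def by (rule taylor_remainder_bound[OF hol bound R]) (use z k in auto)
      also have "\<dots> = K * norm z * norm z ^ j"
        unfolding K_def by (simp add: power_mult_distrib mult_ac power_divide)
      finally have "norm (f n z - (\<Sum>i<Suc j. a n i * z ^ i)) \<le> K * norm z * norm z ^ j" .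
      moreover have "a n j - g n = - (f n z - (\<Sum>i<Suc j. a n i * z ^ i)) / z ^ j"
        unfolding g_def using z(2) by (simp add: field_simps)
      ultimately have "norm (a n j - g n) \<le> K * norm z"
        using z(2) by (simp add: norm_divide norm_power divide_le_eq norm_minus_commute)
      then show ?thesis using k(1) z(1) by simp
    qed
    ultimately show "\<exists>g. convergent g \<and> (\<forall>n. norm ((deriv ^^ j) (f n) 0 / fact j - g n) \<le> e)"
      unfolding a_def by blast
  qed
qed

section \<open>The partition function as an independence polynomial\<close>

text \<open>
  The independent sets of this graph on \<open>V \<times> Inl -` Y\<close> are the graphs of the homomorphisms defined on
  subsets of \<open>V\<close>.
\<close>

definition conflict :: "('a \<times> 'a) set \<Rightarrow> 'a set \<Rightarrow> ('c + 'c set) set \<Rightarrow> (('a \<times> 'c) \<times> ('a \<times> 'c)) set" where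
  "conflict E V Y = {(p, q). p \<in> V \<times> Inl -` Y \<and> q \<in> V \<times> Inl -` Y \<and> snd p \<noteq> snd q \<and>
    (fst p = fst q \<or> (fst p, fst q) \<in> E \<and> {snd p, snd q} \<notin> Inr -` Y)}"

lemma sym_conflict: "sym E \<Longrightarrow> sym (conflict E V Y)"
  unfolding conflict_def sym_def by (auto simp: insert_commute)

text \<open>A pair in conflict with \<open>p\<close> has the first coordinate of \<open>p\<close> or
  a neighbour of it, at most \<open>Suc D\<close> choices, and an arbitrary node of
  \<open>Y\<close>. The size of \<open>V\<close> does not enter, which makes the disc uniform in the
  graph.\<close>

lemma conflict_degree:
  assumes "finite V" "finite Y" "E \<subseteq> V \<times> V" "\<And>v. v \<in> V \<Longrightarrow> card (E `` {v}) \<le> D"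
  shows "finite (conflict E V Y `` {p})" "card (conflict E V Y `` {p}) \<le> Suc D * card (Inl -` Y)"
proof -
  have finE: "finite (E `` {fst p})"
    using assms(1,3) by (intro finite_subset[of "E `` {fst p}" V]) auto
  have finW: "finite (Inl -` Y)" using assms(2) by (rule finite_Inl_vimage)
  have fin: "finite (insert (fst p) (E `` {fst p}) \<times> Inl -` Y)"
    using finE finW by simp
  have sub: "conflict E V Y `` {p} \<subseteq> insert (fst p) (E `` {fst p}) \<times> Inl -` Y"
    unfolding conflict_def by auto
  then show "finite (conflict E V Y `` {p})" using fin by (rule finite_subset)
  show "card (conflict E V Y `` {p}) \<le> Suc D * card (Inl -` Y)"
  proof (cases "fst p \<in> V")
    case True
    have "card (insert (fst p) (E `` {fst p})) \<le> Suc (card (E `` {fst p}))"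
      by (rule card_insert_le_m1) auto
    then have "card (insert (fst p) (E `` {fst p})) \<le> Suc D"
      using assms(4)[OF True] by linarith
    then have "card (insert (fst p) (E `` {fst p}) \<times> Inl -` Y) \<le> Suc D * card (Inl -` Y)"
      unfolding card_cartesian_product by (rule mult_right_mono) simp
    then show ?thesis using card_mono[OF fin sub] by linarith
  next
    case False
    then have "conflict E V Y `` {p} = {}" unfolding conflict_def by auto
    then show ?thesis by simp
  qed
qed

text \<open>Pairs with the same second coordinate never conflict; this reflects the loops of the
  target.\<close>

lemma graph_of_hom_indep:
  assumes "S \<subseteq> V" "\<phi> \<in> looped_homs E Y S"
  shows "(\<lambda>x. (x, \<phi> x)) ` S \<subseteq> V \<times> Inl -` Y" "indep (conflict E V Y) ((\<lambda>x. (x, \<phi> x)) ` S)"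
proof -
  have \<phi>: "\<phi> \<in> S \<rightarrow> Inl -` Y" "edge_image E \<phi> S \<subseteq> Inr -` Y"
    using assms(2) unfolding looped_homs_def hom_image_def by auto
  show "(\<lambda>x. (x, \<phi> x)) ` S \<subseteq> V \<times> Inl -` Y" using \<phi>(1) assms(1) by auto
  have "((x, \<phi> x), (y, \<phi> y)) \<notin> conflict E V Y" if "x \<in> S" "y \<in> S" for x y
  proof
    assume "((x, \<phi> x), (y, \<phi> y)) \<in> conflict E V Y"
    then have "\<phi> x \<noteq> \<phi> y" "(x, y) \<in> E" "{\<phi> x, \<phi> y} \<notin> Inr -` Y"
      unfolding conflict_def by auto
    moreover from this that have "{\<phi> x, \<phi> y} \<in> edge_image E \<phi> S"
      unfolding edge_image_def by blast
    ultimately show False using \<phi>(2) by blast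
  qed
  then show "indep (conflict E V Y) ((\<lambda>x. (x, \<phi> x)) ` S)"
    unfolding indep_def by blast
qed

text \<open>Conflicts over one node force the set to be the graph of a function, and conflicts along
  an edge force that function to preserve adjacency.\<close>

lemma indep_is_graph_of_hom:
  assumes A: "A \<subseteq> V \<times> Inl -` Y" "indep (conflict E V Y) A"
  obtains S \<phi> where "S \<subseteq> V" "\<phi> \<in> looped_homs E Y S" "A = (\<lambda>x. (x, \<phi> x)) ` S"
proof
  let ?S = "fst ` A"
  define \<phi> where "\<phi> = restrict (\<lambda>x. SOME c. (x, c) \<in> A) ?S"
  have fn: "c = d" if "(x, c) \<in> A" "(x, d) \<in> A" for x c d
  proof (rule ccontr)
    assume "c \<noteq> d"
    then have "((x, c), (x, d)) \<in> conflict E V Y"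
      using that A(1) unfolding conflict_def by auto
    then show False using A(2) that \<open>c \<noteq> d\<close> unfolding indep_def by blast
  qed
  have \<phi>A: "(x, \<phi> x) \<in> A" if x: "x \<in> ?S" for x
  proof -
    obtain c where "(x, c) \<in> A" using x by auto
    then have "(x, SOME c. (x, c) \<in> A) \<in> A" by (rule someI)
    then show ?thesis using x by (simp add: \<phi>_def)
  qed
  show "?S \<subseteq> V" using A(1) by auto
  show "A = (\<lambda>x. (x, \<phi> x)) ` ?S"
  proof (intro set_eqI iffI)
    fix p assume p: "p \<in> A"
    then have "fst p \<in> ?S" by simp
    then have "(fst p, \<phi> (fst p)) \<in> A" by (rule \<phi>A)
    then have "snd p = \<phi> (fst p)" using fn[of "fst p" "snd p"] p by simp
    then have "p = (fst p, \<phi> (fst p))" by (simp add: prod_eq_iff)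
    then show "p \<in> (\<lambda>x. (x, \<phi> x)) ` ?S" using \<open>fst p \<in> ?S\<close> by (rule image_eqI)
  next
    fix p assume "p \<in> (\<lambda>x. (x, \<phi> x)) ` ?S"
    then show "p \<in> A" using \<phi>A by blast
  qed
  have in_W: "\<phi> x \<in> Inl -` Y" if "x \<in> ?S" for x
    using \<phi>A[OF that] A(1) by blast
  have "edge_image E \<phi> ?S \<subseteq> Inr -` Y"
  proof
    fix e assume "e \<in> edge_image E \<phi> ?S"
    then obtain x y where xy: "e = {\<phi> x, \<phi> y}" "x \<in> ?S" "y \<in> ?S" "(x, y) \<in> E" "\<phi> x \<noteq> \<phi> y"
      unfolding edge_image_def by blast
    have "((x, \<phi> x), (y, \<phi> y)) \<notin> conflict E V Y"
      using A(2) \<phi>A[OF xy(2)] \<phi>A[OF xy(3)] xy(5) unfolding indep_def by blast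
    moreover have "(x, \<phi> x) \<in> V \<times> Inl -` Y" "(y, \<phi> y) \<in> V \<times> Inl -` Y"
      using \<phi>A[OF xy(2)] \<phi>A[OF xy(3)] A(1) by blast+
    ultimately show "e \<in> Inr -` Y"
      using xy unfolding conflict_def by simp
  qed
  moreover have "\<phi> \<in> extensional ?S" unfolding \<phi>_def by simp
  ultimately show "\<phi> \<in> looped_homs E Y ?S"
    unfolding looped_homs_def hom_image_def using in_W by (auto simp: PiE_iff)
qed

lemma indep_poly_conflict:
  assumes "finite V" "finite Y"
  shows "indep_poly (conflict E V Y) (V \<times> Inl -` Y) z =
    (\<Sum>S\<in>Pow V. of_nat (card (looped_homs E Y S)) * z ^ card S)"
proof -
  let ?h = "\<lambda>(S, \<phi>). (\<lambda>x. (x, \<phi> x)) ` S"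
  let ?D = "SIGMA S:Pow V. looped_homs E Y S"
  have fin: "finite (looped_homs E Y S)" if "S \<in> Pow V" for S
  proof -
    have "finite (S \<rightarrow>\<^sub>E Inl -` Y)"
      using that assms by (intro finite_PiE finite_Inl_vimage) (auto intro: finite_subset)
    then show ?thesis unfolding looped_homs_def by simp
  qed
  have "inj_on ?h ?D"
  proof (rule inj_onI, clarify)
    fix S \<phi> T \<psi>
    assume S: "\<phi> \<in> looped_homs E Y S" and T: "\<psi> \<in> looped_homs E Y T"
      and eq: "(\<lambda>x. (x, \<phi> x)) ` S = (\<lambda>x. (x, \<psi> x)) ` T"
    have "fst ` (\<lambda>x. (x, \<phi> x)) ` S = fst ` (\<lambda>x. (x, \<psi> x)) ` T" using eq by simp
    then have "S = T" by (simp add: image_image)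
    moreover have "\<phi> = \<psi>"
    proof (rule extensionalityI)
      show "\<phi> \<in> extensional S" "\<psi> \<in> extensional S"
        using S T \<open>S = T\<close> unfolding looped_homs_def by (auto simp: PiE_iff)
      fix x assume "x \<in> S"
      then have "(x, \<phi> x) \<in> (\<lambda>x. (x, \<psi> x)) ` T" using eq by blast
      then show "\<phi> x = \<psi> x" by auto
    qed
    ultimately show "S = T \<and> \<phi> = \<psi>" by simp
  qed
  moreover have "?h ` ?D = {A. A \<subseteq> V \<times> Inl -` Y \<and> indep (conflict E V Y) A}"
  proof (intro set_eqI iffI)
    fix A assume "A \<in> ?h ` ?D"
    then obtain S \<phi> where "S \<subseteq> V" "\<phi> \<in> looped_homs E Y S" "A = (\<lambda>x. (x, \<phi> x)) ` S"
      by auto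
    then show "A \<in> {A. A \<subseteq> V \<times> Inl -` Y \<and> indep (conflict E V Y) A}"
      using graph_of_hom_indep[of S V \<phi> E Y] by simp
  next
    fix A assume "A \<in> {A. A \<subseteq> V \<times> Inl -` Y \<and> indep (conflict E V Y) A}"
    then have "A \<subseteq> V \<times> Inl -` Y" "indep (conflict E V Y) A" by simp_all
    then obtain S \<phi> where "S \<subseteq> V" "\<phi> \<in> looped_homs E Y S" "A = (\<lambda>x. (x, \<phi> x)) ` S"
      by (rule indep_is_graph_of_hom)
    then show "A \<in> ?h ` ?D" by (intro image_eqI[of _ _ "(S, \<phi>)"]) auto
  qed
  ultimately have bij: "bij_betw ?h ?D {A. A \<subseteq> V \<times> Inl -` Y \<and> indep (conflict E V Y) A}"
    unfolding bij_betw_def by blast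
  have "indep_poly (conflict E V Y) (V \<times> Inl -` Y) z = (\<Sum>p\<in>?D. z ^ card (?h p))"
    unfolding indep_poly_def by (rule sum.reindex_bij_betw[OF bij, symmetric])
  also have "\<dots> = (\<Sum>(S, \<phi>)\<in>?D. z ^ card S)"
    by (intro sum.cong refl) (auto simp: card_image inj_on_def)
  also have "\<dots> = (\<Sum>S\<in>Pow V. \<Sum>\<phi>\<in>looped_homs E Y S. z ^ card S)"
    by (rule sum.Sigma[symmetric]) (use assms fin in auto)
  finally show ?thesis by simp
qed

lemma hom_series_expansion:
  fixes Y :: "('c + 'c set) set"
  assumes "finite V"
  shows "(\<lambda>z. \<Sum>S\<in>Pow V. of_nat (card (looped_homs E Y S)) * z ^ card S) has_fps_expansion hom_series E V Y"
proof -
  have "(\<lambda>z::complex. \<Sum>S\<in>Pow V. of_nat (card (looped_homs E Y S)) * z ^ card S) has_fps_expansion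
      (\<Sum>S\<in>Pow V. fps_const (of_nat (card (looped_homs E Y S))) * fps_X ^ card S)"
    by (intro has_fps_expansion_sum has_fps_expansion_cmult_left has_fps_expansion_fps_X_power)
  also have "(\<Sum>S\<in>Pow V. fps_const (of_nat (card (looped_homs E Y S))) * fps_X ^ card S) = hom_series E V Y"
  proof (rule fps_ext)
    fix j
    have "(\<Sum>S\<in>Pow V. (of_nat (card (looped_homs E Y S)) :: complex) * (if j = card S then 1 else 0)) =
        (\<Sum>S\<in>{S. S \<subseteq> V \<and> card S = j}. of_nat (card (looped_homs E Y S)))"
      using assms by (intro sum.mono_neutral_cong_right) auto
    then show "fps_nth (\<Sum>S\<in>Pow V. fps_const (of_nat (card (looped_homs E Y S))) * fps_X ^ card S) j =
        fps_nth (hom_series E V Y) j"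
      by (simp add: hom_series_def fps_sum_nth fps_X_power_nth)
  qed
  finally show ?thesis .
qed

text \<open>The bridge between the analytic and the formal logarithm: differentiating exp L = f
  gives L' f = f' near 0, and expansions are unique, so the formal quotient F'/F is the expansion of
  L'.\<close>

lemma log_taylor_coeffs:
  fixes L f :: "complex \<Rightarrow> complex"
  assumes L: "L holomorphic_on ball 0 R" "R > 0" and exp: "\<And>z. z \<in> ball 0 R \<Longrightarrow> exp (L z) = f z"
    and F: "f has_fps_expansion F" "fps_nth F 0 \<noteq> 0"
  shows "fps_nth (fps_deriv F * inverse F) j = of_nat (Suc j) * ((deriv ^^ Suc j) L 0 / fact (Suc j))"
proof -
  let ?l = "fps_expansion L 0"
  have l: "L has_fps_expansion ?l"
    using L by (intro has_fps_expansion_fps_expansion[of "ball 0 R"]) auto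
  have prod: "(\<lambda>z. deriv L z * f z) has_fps_expansion fps_deriv ?l * F"
    by (intro has_fps_expansion_mult has_fps_expansion_deriv l F)
  have ev: "\<forall>\<^sub>F z in nhds 0. deriv L z * f z = deriv f z"
  proof -
    have "\<forall>\<^sub>F z in nhds 0. z \<in> ball (0::complex) R"
      using L(2) by (intro eventually_nhds_in_open) auto
    then show ?thesis
    proof eventually_elim
      case (elim z)
      have "(L has_field_derivative deriv L z) (at z)"
        using L(1) elim by (intro holomorphic_derivI[of L "ball 0 R"]) auto
      then have "((\<lambda>z. exp (L z)) has_field_derivative exp (L z) * deriv L z) (at z)"
        by (rule DERIV_chain2[OF DERIV_exp])
      then have "(f has_field_derivative exp (L z) * deriv L z) (at z)"
        by (rule DERIV_cong_ev[THEN iffD1, rotated -1])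
           (use elim exp in \<open>auto intro!: eventually_mono[OF eventually_nhds_in_open[of "ball 0 R"]]\<close>)
      then have "deriv f z = exp (L z) * deriv L z" by (rule DERIV_imp_deriv)
      then show ?case using exp[OF elim] by (simp add: mult.commute)
    qed
  qed
  have "deriv f has_fps_expansion fps_deriv ?l * F"
    using prod has_fps_expansion_cong[OF ev refl] by blast
  moreover have "deriv f has_fps_expansion fps_deriv F"
    by (rule has_fps_expansion_deriv[OF F(1)])
  ultimately have "fps_deriv F = fps_deriv ?l * F"
    using fps_expansion_unique_complex by blast
  then have "fps_deriv F * inverse F = fps_deriv ?l"
    using inverse_mult_eq_1'[OF F(2)] by (simp add: mult.assoc)
  then show ?thesis by (simp add: fps_expansion_def)
qed


section \<open>Adding universal nodes\<close>

text \<open>An edge of \<open>Y\<close> with an end outside the node set creates no arc, so every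
  finite \<open>Y\<close> yields a legitimate target. Inclusion-exclusion over all subsets, dangling
  edges included, relies on this.\<close>

definition cone_graph :: "('c + 'c set) set \<Rightarrow> 'c set \<Rightarrow> 'c pair_pre_digraph" where
  "cone_graph Y K = \<lparr>pverts = Inl -` Y \<union> K, parcs = {(c, d). c \<in> Inl -` Y \<union> K \<and> d \<in> Inl -` Y \<union> K \<and>
    (c = d \<or> c \<in> K \<or> d \<in> K \<or> {c, d} \<in> Inr -` Y)}\<rparr>"

lemma simple_looped_cone_graph:
  assumes "finite Y" "finite K"
  shows "simple_looped_graph (cone_graph Y K)"
proof -
  define M where "M = \<lparr>pverts = pverts (cone_graph Y K), parcs = parcs (cone_graph Y K) - Id\<rparr>"
  have fin: "finite (pverts M)"
    using assms by (simp add: M_def cone_graph_def finite_Inl_vimage)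
  have sub: "parcs M \<subseteq> pverts M \<times> pverts M"
    by (auto simp: M_def cone_graph_def)
  have "pair_graph M"
  proof
    show "finite (pverts M)" by fact
    show "finite (parcs M)" using fin sub finite_subset by blast
    show "symmetric (with_proj M)"
      unfolding symmetric_def sym_def with_proj_simps
      by (auto simp: M_def cone_graph_def insert_commute)
  qed (use sub in \<open>auto simp: M_def\<close>)
  moreover have "cone_graph Y K = add_loops M"
    unfolding add_loops_def M_def cone_graph_def by (auto simp: Id_on_def)
  ultimately show ?thesis unfolding simple_looped_graph_def by blast
qed

lemma cone_graph_degree:
  assumes "finite Y" "finite K" "v \<in> pverts (cone_graph Y K)"
  shows "card K \<le> out_degree (with_proj (cone_graph Y K)) v"
proof -
  have sub: "Pair v ` K \<subseteq> out_arcs (with_proj (cone_graph Y K)) v"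
    using assms(3) unfolding out_arcs_def by (auto simp: cone_graph_def)
  have "out_arcs (with_proj (cone_graph Y K)) v \<subseteq> {v} \<times> (Inl -` Y \<union> K)"
    unfolding out_arcs_def by (auto simp: cone_graph_def)
  then have "finite (out_arcs (with_proj (cone_graph Y K)) v)"
    by (rule finite_subset) (use assms finite_Inl_vimage in auto)
  then have "card (Pair v ` K) \<le> out_degree (with_proj (cone_graph Y K)) v"
    unfolding out_degree_def using sub by (rule card_mono)
  then show ?thesis by (simp add: card_image inj_on_def)
qed

text \<open>Every arc touching \<open>K\<close> is present, so the nodes outside \<open>S\<close>
  choose their images in \<open>K\<close> freely and independently. The only constraint left is that
  the restriction to \<open>S\<close> is a homomorphism into \<open>Y\<close>.\<close>

lemma card_cone_homs_on:
  fixes Y :: "('c + 'c set) set"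
  assumes "finite (pverts G)" "finite Y" "finite K" "Inl -` Y \<inter> K = {}"
    and G: "parcs G \<subseteq> pverts G \<times> pverts G" and S: "S \<subseteq> pverts G"
  shows "card {\<phi> \<in> graph_homs G (cone_graph Y K). {v \<in> pverts G. \<phi> v \<in> Inl -` Y} = S} =
    card (looped_homs (parcs G) Y S) * card K ^ (card (pverts G) - card S)"
proof -
  let ?V = "pverts G" and ?W = "Inl -` Y :: 'c set"
  let ?A = "{\<phi> \<in> graph_homs G (cone_graph Y K). {v \<in> ?V. \<phi> v \<in> ?W} = S}"
  let ?B = "looped_homs (parcs G) Y S \<times> ((?V - S) \<rightarrow>\<^sub>E K)"
  let ?f = "\<lambda>\<phi>. (restrict \<phi> S, restrict \<phi> (?V - S))"
  let ?g = "\<lambda>(\<alpha>, \<beta>) x. if x \<in> S then \<alpha> x else \<beta> x"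
  have f: "?f \<phi> \<in> ?B" if \<phi>: "\<phi> \<in> ?A" for \<phi>
  proof -
    have map: "\<phi> x \<in> ?W \<union> K" if "x \<in> ?V" for x
      using \<phi> that unfolding graph_homs_def cone_graph_def by auto
    have arc: "\<phi> x = \<phi> y \<or> \<phi> x \<in> K \<or> \<phi> y \<in> K \<or> {\<phi> x, \<phi> y} \<in> Inr -` Y" if "(x, y) \<in> parcs G" for x y
      using \<phi> that unfolding graph_homs_def cone_graph_def by fastforce
    have inS: "\<phi> x \<in> ?W \<longleftrightarrow> x \<in> S" if "x \<in> ?V" for x
      using \<phi> that by auto
    have "edge_image (parcs G) (restrict \<phi> S) S \<subseteq> Inr -` Y"
    proof
      fix e assume "e \<in> edge_image (parcs G) (restrict \<phi> S) S"
      then obtain x y where xy: "x \<in> S" "y \<in> S" "(x, y) \<in> parcs G" "\<phi> x \<noteq> \<phi> y" "e = {\<phi> x, \<phi> y}"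
        unfolding edge_image_def by auto
      then have "\<phi> x \<in> ?W" "\<phi> y \<in> ?W" using inS S by blast+
      then show "e \<in> Inr -` Y" using arc[OF xy(3)] xy(4,5) assms(4) by blast
    qed
    moreover have "restrict \<phi> S \<in> S \<rightarrow>\<^sub>E ?W"
      using inS S by (auto simp: PiE_iff)
    ultimately have "restrict \<phi> S \<in> looped_homs (parcs G) Y S"
      unfolding looped_homs_def hom_image_def by (auto simp: PiE_iff)
    moreover have "\<phi> x \<in> K" if "x \<in> ?V - S" for x
      using map[of x] inS[of x] that by blast
    ultimately show ?thesis by (auto simp: PiE_iff)
  qed
  have g: "?g p \<in> ?A" if p: "p \<in> ?B" for p
  proof -
    obtain \<alpha> \<beta> where ab: "p = (\<alpha>, \<beta>)" "\<alpha> \<in> looped_homs (parcs G) Y S" "\<beta> \<in> (?V - S) \<rightarrow>\<^sub>E K"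
      using p by blast
    have \<alpha>: "\<alpha> \<in> S \<rightarrow>\<^sub>E ?W" "edge_image (parcs G) \<alpha> S \<subseteq> Inr -` Y"
      using ab(2) unfolding looped_homs_def hom_image_def by auto
    define \<phi> where "\<phi> = ?g p"
    have \<phi>S: "\<phi> x = \<alpha> x" "\<phi> x \<in> ?W" if "x \<in> S" for x
      using that \<alpha>(1) unfolding \<phi>_def ab(1) by auto
    have \<phi>K: "\<phi> x \<in> K" if "x \<in> ?V - S" for x
      using that ab(3) unfolding \<phi>_def ab(1) by auto
    have \<phi>E: "\<phi> x = undefined" if "x \<notin> ?V" for x
      using that ab(3) S unfolding \<phi>_def ab(1) by (auto simp: PiE_iff extensional_def)
    have V: "\<phi> x \<in> ?W \<union> K" if "x \<in> ?V" for x
      using that \<phi>S \<phi>K by blast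
    have "\<phi> x = \<phi> y \<or> \<phi> x \<in> K \<or> \<phi> y \<in> K \<or> {\<phi> x, \<phi> y} \<in> Inr -` Y" if xy: "(x, y) \<in> parcs G" for x y
    proof (cases "x \<in> S \<and> y \<in> S \<and> \<phi> x \<noteq> \<phi> y")
      case True
      then have "\<phi> x = \<alpha> x" "\<phi> y = \<alpha> y" "\<alpha> x \<noteq> \<alpha> y" using \<phi>S(1) by auto
      then have "{\<phi> x, \<phi> y} \<in> edge_image (parcs G) \<alpha> S"
        using xy True unfolding edge_image_def mem_Collect_eq
        by (intro exI[of _ x] exI[of _ y]) simp
      then show ?thesis using \<alpha>(2) by blast
    next
      case False
      then show ?thesis using \<phi>K xy G by blast
    qed
    then have "\<phi> \<in> graph_homs G (cone_graph Y K)"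
      unfolding graph_homs_def cone_graph_def using V G \<phi>E by (auto simp: PiE_iff extensional_def)
    moreover have "{v \<in> ?V. \<phi> v \<in> ?W} = S"
      using \<phi>S(2) \<phi>K S assms(4) by blast
    ultimately show ?thesis unfolding \<phi>_def by blast
  qed
  have "bij_betw ?f ?A ?B"
  proof (rule bij_betw_byWitness[where f' = ?g])
    show "\<forall>\<phi>\<in>?A. ?g (?f \<phi>) = \<phi>"
    proof
      fix \<phi> assume "\<phi> \<in> ?A"
      then have "\<phi> \<in> extensional ?V" unfolding graph_homs_def by (simp add: PiE_iff)
      then show "?g (?f \<phi>) = \<phi>" using S by (auto simp: fun_eq_iff extensional_def)
    qed
    show "\<forall>p\<in>?B. ?f (?g p) = p"
    proof
      fix p assume p: "p \<in> ?B"
      obtain \<alpha> \<beta> where ab: "p = (\<alpha>, \<beta>)" "\<alpha> \<in> looped_homs (parcs G) Y S" "\<beta> \<in> (?V - S) \<rightarrow>\<^sub>E K"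
        using p by blast
      then have "\<alpha> \<in> extensional S" "\<beta> \<in> extensional (?V - S)"
        unfolding looped_homs_def by (auto simp: PiE_iff)
      then show "?f (?g p) = p"
        using S unfolding ab(1) by (auto simp: fun_eq_iff extensional_def restrict_def)
    qed
    show "?f ` ?A \<subseteq> ?B" using f by (rule image_subsetI)
    show "?g ` ?B \<subseteq> ?A" using g by (rule image_subsetI)
  qed
  then have "card ?A = card ?B" by (rule bij_betw_same_card)
  also have "\<dots> = card (looped_homs (parcs G) Y S) * card K ^ card (?V - S)"
    using assms(1) by (simp add: card_cartesian_product card_PiE)
  also have "card (?V - S) = card ?V - card S"
    using S assms(1) by (simp add: card_Diff_subset finite_subset)
  finally show ?thesis .
qed

lemma hom_count_cone_graph:
  assumes "finite (pverts G)" "finite Y" "finite K" "Inl -` Y \<inter> K = {}" "K \<noteq> {}"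
    and G: "parcs G \<subseteq> pverts G \<times> pverts G"
  shows "real (hom_count G (cone_graph Y K)) = real (card K) ^ card (pverts G) *
    indep_poly (conflict (parcs G) (pverts G) Y) (pverts G \<times> Inl -` Y) (1 / real (card K))"
proof -
  let ?V = "pverts G"
  have "finite (?V \<rightarrow>\<^sub>E pverts (cone_graph Y K))"
    using assms finite_Inl_vimage by (intro finite_PiE) (auto simp: cone_graph_def)
  then have fin: "finite (graph_homs G (cone_graph Y K))"
    unfolding graph_homs_def by simp
  have "hom_count G (cone_graph Y K) = (\<Sum>\<phi>\<in>graph_homs G (cone_graph Y K). 1)"
    by (simp add: hom_count_def)
  also have "\<dots> = (\<Sum>S\<in>Pow ?V. \<Sum>\<phi> | \<phi> \<in> graph_homs G (cone_graph Y K) \<and> {v \<in> ?V. \<phi> v \<in> Inl -` Y} = S. 1)"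
    by (rule sum.group[symmetric]) (use fin assms(1) in auto)
  also have "\<dots> = (\<Sum>S\<in>Pow ?V. card (looped_homs (parcs G) Y S) * card K ^ (card ?V - card S))"
    using card_cone_homs_on[OF assms(1-4) G] by (intro sum.cong) auto
  finally have "real (hom_count G (cone_graph Y K)) =
      (\<Sum>S\<in>Pow ?V. real (card (looped_homs (parcs G) Y S)) * real (card K) ^ (card ?V - card S))"
    by simp
  also have "\<dots> = (\<Sum>S\<in>Pow ?V. real (card K) ^ card ?V *
      (real (card (looped_homs (parcs G) Y S)) * (1 / real (card K)) ^ card S))"
  proof (intro sum.cong refl)
    fix S assume "S \<in> Pow ?V"
    then have "card S \<le> card ?V" using assms(1) by (simp add: card_mono)
    then show "real (card (looped_homs (parcs G) Y S)) * real (card K) ^ (card ?V - card S) =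
        real (card K) ^ card ?V * (real (card (looped_homs (parcs G) Y S)) * (1 / real (card K)) ^ card S)"
      using assms(3,5) by (simp add: power_diff power_one_over field_simps)
  qed
  finally show ?thesis
    unfolding indep_poly_conflict[OF assms(1,2)] by (simp add: sum_distrib_left)
qed

lemma pair_graph_parcs:
  assumes "pair_graph G"
  shows "finite (pverts G)" "parcs G \<subseteq> pverts G \<times> pverts G" "sym (parcs G)" "\<And>x. (x, x) \<notin> parcs G"
proof -
  interpret pair_graph G by (rule assms)
  show "finite (pverts G)" by (rule pair_finite_verts)
  show "parcs G \<subseteq> pverts G \<times> pverts G" using arc_fst_in_verts arc_snd_in_verts by force
  show "sym (parcs G)" using pair_sym_arcs by (simp add: symmetric_def)
  show "(x, x) \<notin> parcs G" for x using pair_no_loops by force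
qed

lemma out_degree_eq_card_Image: "out_degree (with_proj G) v = card (parcs G `` {v})"
proof -
  have "out_arcs (with_proj G) v = Pair v ` (parcs G `` {v})"
    unfolding out_arcs_def by auto
  then show ?thesis unfolding out_degree_def by (simp add: card_image inj_on_def)
qed

lemma log_deriv_series_convergent:
  fixes G :: "nat \<Rightarrow> 'a pair_pre_digraph" and Y :: "(nat + nat set) set"
  assumes G: "\<And>n. pair_graph (G n)" "\<And>n. pverts (G n) \<noteq> {}"
    and deg: "\<And>n v. v \<in> pverts (G n) \<Longrightarrow> out_degree (with_proj (G n)) v \<le> D"
    and \<delta>: "\<delta> > 0" and conv: "\<And>H :: nat pair_pre_digraph.
        simple_looped_graph H \<Longrightarrow> pverts H \<noteq> {} \<Longrightarrow>
        (\<forall>v \<in> pverts H. real (out_degree (with_proj H) v) \<ge> (1 - \<delta>) * real (card (pverts H))) \<Longrightarrow>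
        convergent (\<lambda>n. ln (real (hom_count (G n) H)) / real (card (pverts (G n))))"
    and Y: "finite Y"
  shows "convergent (\<lambda>n. fps_nth (log_deriv_series (parcs (G n)) (pverts (G n)) Y) j / of_nat (card (pverts (G n))))"
proof -
  let ?V = "\<lambda>n. pverts (G n)" and ?E = "\<lambda>n. parcs (G n)" and ?W = "Inl -` Y :: nat set"
  note finV = pair_graph_parcs(1)[OF G(1)] and E = pair_graph_parcs(2)[OF G(1)]
    and symE = pair_graph_parcs(3)[OF G(1)]
  have degE: "card (?E n `` {v}) \<le> D" if "v \<in> ?V n" for n v
    using deg[OF that] by (simp add: out_degree_eq_card_Image)
  have finW: "finite ?W" using Y by (rule finite_Inl_vimage)
  \<comment> \<open>This is the degree bound of \<open>conflict_degree\<close>; with it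
    \<open>R\<close> depends on \<open>D\<close> and \<open>Y\<close> but not on
    \<open>n\<close>.\<close>
  define \<Delta> where "\<Delta> = Suc D * card ?W"
  define R :: real where "R = 1 / 2 ^ (\<Delta> + 2)"
  have R: "R > 0" "R * 2 ^ (\<Delta> + 2) \<le> 1" by (auto simp: R_def)
  have "\<exists>L. L holomorphic_on ball 0 R \<and>
    (\<forall>z\<in>ball 0 R. exp (L z) = indep_poly (conflict (?E n) (?V n) Y) (?V n \<times> ?W) z \<and> norm (L z) \<le> card (?V n \<times> ?W)) \<and>
    (\<forall>x. 0 \<le> x \<longrightarrow> x < R \<longrightarrow> L (complex_of_real x) =
      of_real (ln (indep_poly (conflict (?E n) (?V n) Y) (?V n \<times> ?W) x)))" for n
  proof (rule indep_poly_log[OF _ sym_conflict[OF symE] _ _ R(2)])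
    show "finite (?V n \<times> ?W)" using finV finW by simp
    show "card (conflict (?E n) (?V n) Y `` {x}) \<le> \<Delta>" "finite (conflict (?E n) (?V n) Y `` {x})" for x
      unfolding \<Delta>_def using conflict_degree[OF finV Y E degE] by auto
  qed
  then obtain L where L: "\<And>n. L n holomorphic_on ball 0 R"
    "\<And>n z. z \<in> ball 0 R \<Longrightarrow> exp (L n z) = indep_poly (conflict (?E n) (?V n) Y) (?V n \<times> ?W) z"
    "\<And>n z. z \<in> ball 0 R \<Longrightarrow> norm (L n z) \<le> card (?V n \<times> ?W)"
    "\<And>n x. 0 \<le> x \<Longrightarrow> x < R \<Longrightarrow> L n (complex_of_real x) =
      of_real (ln (indep_poly (conflict (?E n) (?V n) Y) (?V n \<times> ?W) x))"
    by metis
  have cardV: "card (?V n) > 0" for n using finV G(2) by (simp add: card_gt_0_iff)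
  define f where "f n z = L n z / of_nat (card (?V n))" for n z
  have hol: "f n holomorphic_on ball 0 R" for n
    unfolding f_def by (intro holomorphic_intros L(1)) (use cardV in auto)
  have bound: "norm (f n z) \<le> card ?W" if "z \<in> ball 0 R" for n z
  proof -
    have "norm (L n z) \<le> real (card (?V n)) * real (card ?W)"
      using L(3)[OF that, of n] by (simp add: card_cartesian_product)
    then show ?thesis using cardV[of n] by (simp add: f_def norm_divide divide_le_eq mult.commute)
  qed
  \<comment> \<open>The three summands give \<open>card ?W \<le> \<delta> * k\<close>, which is the
    degree condition, then \<open>1 / k\<close> inside the disc, and a nonempty
    \<open>K\<close>.\<close>
  obtain k0 :: nat where k0: "k0 > card ?W / \<delta> + 1 / R + 1"
    using reals_Archimedean2 by blast
  have "convergent (\<lambda>n. f n (1 / of_nat k))" if k: "k \<ge> k0" for k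
  proof -
    have nn: "card ?W / \<delta> \<ge> 0" "1 / R \<ge> 0" using \<delta> R by auto
    have "real k \<ge> real k0" using k by simp
    then have "real k > card ?W / \<delta> \<and> real k > 1 / R \<and> real k > 1"
      using k0 nn by linarith
    then have k': "card ?W / \<delta> < k" "1 / R < k" "1 < real k" by auto
    then have kR: "1 / real k < R" using R(1) by (simp add: field_simps)
    have "infinite (UNIV - ?W)" using finW by simp
    then obtain K where K: "finite K" "card K = k" "K \<subseteq> UNIV - ?W"
      using infinite_arbitrarily_large[of "UNIV - ?W" k] by blast
    have disj: "?W \<inter> K = {}" using K(3) by blast
    have Kne: "K \<noteq> {}" using K(2) k'(3) by auto
    let ?H = "cone_graph Y K"
    have "convergent (\<lambda>n. ln (real (hom_count (G n) ?H)) / real (card (?V n)))"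
    proof (rule conv)
      show "simple_looped_graph ?H" using Y K(1) by (rule simple_looped_cone_graph)
      show "pverts ?H \<noteq> {}" using Kne by (simp add: cone_graph_def)
      show "\<forall>v\<in>pverts ?H. (1 - \<delta>) * real (card (pverts ?H)) \<le> real (out_degree (with_proj ?H) v)"
      proof
        fix v assume "v \<in> pverts ?H"
        then have "real k \<le> out_degree (with_proj ?H) v"
          using cone_graph_degree[OF Y K(1)] K(2) by simp
        moreover have "card (pverts ?H) = card ?W + k"
          using finW K disj by (simp add: cone_graph_def card_Un_disjoint)
        moreover have "(1 - \<delta>) * (real (card ?W) + real k) \<le> real k"
        proof -
          have "real (card ?W) \<le> \<delta> * real k" using k'(1) \<delta> by (simp add: field_simps)
          moreover have "0 \<le> \<delta> * real (card ?W)" using \<delta> by simp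
          ultimately show ?thesis by (simp add: algebra_simps)
        qed
        ultimately show "(1 - \<delta>) * real (card (pverts ?H)) \<le> real (out_degree (with_proj ?H) v)"
          by simp
      qed
    qed
    \<comment> \<open>The factor \<open>k ^ card (?V n)\<close> of the homomorphism count becomes
      exactly \<open>ln k\<close> after normalisation, which is constant in
      \<open>n\<close>.\<close>
    then have "convergent (\<lambda>n. ln (real (hom_count (G n) ?H)) / real (card (?V n)) - ln k)"
      by (intro convergent_diff convergent_const)
    then have "convergent (\<lambda>n. complex_of_real (ln (real (hom_count (G n) ?H)) / real (card (?V n)) - ln k))"
      using tendsto_of_real unfolding convergent_def by metis
    moreover have "complex_of_real (ln (real (hom_count (G n) ?H)) / real (card (?V n)) - ln k) = f n (1 / of_nat k)" for n
    proof -
      have pos: "indep_poly (conflict (?E n) (?V n) Y) (?V n \<times> ?W) (1 / real k) \<ge> 1"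
        by (rule indep_poly_ge_1) (use finV finW in auto)
      have "real (hom_count (G n) ?H) = real k ^ card (?V n) * indep_poly (conflict (?E n) (?V n) Y) (?V n \<times> ?W) (1 / real k)"
        using hom_count_cone_graph[OF finV Y K(1) disj Kne E] K(2) by simp
      then have "ln (real (hom_count (G n) ?H)) = card (?V n) * ln k + ln (indep_poly (conflict (?E n) (?V n) Y) (?V n \<times> ?W) (1 / real k))"
        using k'(3) pos by (simp add: ln_mult_pos ln_realpow)
      then have "ln (real (hom_count (G n) ?H)) / real (card (?V n)) - ln k =
          ln (indep_poly (conflict (?E n) (?V n) Y) (?V n \<times> ?W) (1 / real k)) / card (?V n)"
        using cardV[of n] by (simp add: field_simps)
      moreover have "L n (1 / of_nat k) = of_real (ln (indep_poly (conflict (?E n) (?V n) Y) (?V n \<times> ?W) (1 / real k)))"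
        using L(4)[of "1 / real k" n] kR by simp
      ultimately show ?thesis unfolding f_def by simp
    qed
    ultimately show ?thesis by simp
  qed
  then have "convergent (\<lambda>n. (deriv ^^ Suc j) (f n) 0 / fact (Suc j))"
    using hol R(1) bound by (intro taylor_coeffs_convergent[of f R "card ?W" k0 "Suc j"])
  then have "convergent (\<lambda>n. of_nat (Suc j) * ((deriv ^^ Suc j) (f n) 0 / fact (Suc j)))"
    by (intro convergent_mult convergent_const)
  moreover have "of_nat (Suc j) * ((deriv ^^ Suc j) (f n) 0 / fact (Suc j)) =
      fps_nth (log_deriv_series (?E n) (?V n) Y) j / of_nat (card (?V n))" for n
  proof -
    have "(deriv ^^ Suc j) (f n) 0 = (deriv ^^ Suc j) (L n) 0 / of_nat (card (?V n))"
    proof -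
      have "f n = (\<lambda>z. inverse (of_nat (card (?V n))) * L n z)"
        unfolding f_def by (simp add: fun_eq_iff field_simps)
      then show ?thesis
        using higher_deriv_cmult[of "L n" "ball 0 R" 0 "Suc j" "inverse (of_nat (card (?V n)))"] L(1)[of n] R(1)
        by (simp add: field_simps)
    qed
    moreover have "fps_nth (log_deriv_series (?E n) (?V n) Y) j =
        of_nat (Suc j) * ((deriv ^^ Suc j) (L n) 0 / fact (Suc j))"
      unfolding log_deriv_series_def
    proof (rule log_taylor_coeffs[OF L(1) R(1)])
      show "(\<lambda>z. \<Sum>S\<in>Pow (?V n). of_nat (card (looped_homs (?E n) Y S)) * z ^ card S)
          has_fps_expansion hom_series (?E n) (?V n) Y"
        using finV by (rule hom_series_expansion)
      show "exp (L n z) = (\<Sum>S\<in>Pow (?V n). of_nat (card (looped_homs (?E n) Y S)) * z ^ card S)"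
        if "z \<in> ball 0 R" for z
        using L(2)[OF that] indep_poly_conflict[OF finV Y] by simp
      show "fps_nth (hom_series (?E n) (?V n) Y) 0 \<noteq> 0"
        by (simp add: hom_series_0 finV)
    qed
    ultimately show ?thesis by simp
  qed
  ultimately show ?thesis by simp
qed

section \<open>Balls\<close>

text \<open>Defined for a bare relation, so that a ball inside a node subset \<open>T\<close> is
  obtained by restricting \<open>E\<close> to \<open>T\<close>.\<close>

definition walk_ball :: "('a \<times> 'a) set \<Rightarrow> 'a \<Rightarrow> nat \<Rightarrow> 'a set" where
  "walk_ball E v r = {u. \<exists>i\<le>r. (v, u) \<in> E ^^ i}"

lemma walk_ball_conv_Image: "walk_ball E v r = (\<Union>i\<le>r. (E ^^ i) `` {v})"
  unfolding walk_ball_def by auto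

lemma centre_in_walk_ball: "v \<in> walk_ball E v r"
  unfolding walk_ball_def by (auto intro: exI[of _ 0])

lemma relpow_mono_rel: "A \<subseteq> B \<Longrightarrow> (A :: ('a \<times> 'a) set) ^^ i \<subseteq> B ^^ i"
  by (induction i) (auto simp: relcomp_mono)

lemma walk_ball_mono: "A \<subseteq> B \<Longrightarrow> walk_ball A v r \<subseteq> walk_ball B v r"
  unfolding walk_ball_def using relpow_mono_rel by blast

lemma walk_ball_subset:
  assumes "v \<in> T"
  shows "walk_ball (E \<inter> T \<times> T) v r \<subseteq> T"
proof
  fix u assume "u \<in> walk_ball (E \<inter> T \<times> T) v r"
  then obtain i where "(v, u) \<in> (E \<inter> T \<times> T) ^^ i" unfolding walk_ball_def by blast
  then show "u \<in> T" using assms by (cases i) auto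
qed

text \<open>A node out of reach inside \<open>S\<close> is also out of reach inside any smaller set,
  so no walk of length at most \<open>r\<close> from the root ever visits it.\<close>

lemma walk_ball_insert:
  assumes u: "u \<notin> walk_ball (E \<inter> S \<times> S) v r" and T: "insert u T \<subseteq> S"
  shows "walk_ball (E \<inter> insert u T \<times> insert u T) v r = walk_ball (E \<inter> T \<times> T) v r"
proof
  show "walk_ball (E \<inter> T \<times> T) v r \<subseteq> walk_ball (E \<inter> insert u T \<times> insert u T) v r"
    by (rule walk_ball_mono) blast
  let ?R = "E \<inter> insert u T \<times> insert u T"
  have RS: "?R \<subseteq> E \<inter> S \<times> S" using T by blast
  have not_u: "x \<noteq> u" if "(v, x) \<in> ?R ^^ i" "i \<le> r" for x i
    using u that relpow_mono_rel[OF RS, of i] unfolding walk_ball_def by blast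
  have "(v, x) \<in> (E \<inter> T \<times> T) ^^ i" if "(v, x) \<in> ?R ^^ i" "i \<le> r" for x i
    using that
  proof (induction i arbitrary: x)
    case (Suc i)
    from Suc.prems(1) obtain y where y: "(v, y) \<in> ?R ^^ i" "(y, x) \<in> ?R"
      by (rule relpow_Suc_E)
    have "x \<noteq> u" "y \<noteq> u" using not_u[OF Suc.prems] not_u[OF y(1)] Suc.prems(2) by auto
    then have "(y, x) \<in> E \<inter> T \<times> T" using y(2) by blast
    moreover have "(v, y) \<in> (E \<inter> T \<times> T) ^^ i" using Suc.IH[OF y(1)] Suc.prems(2) by simp
    ultimately show ?case by (rule relpow_Suc_I[rotated])
  qed simp
  then show "walk_ball ?R v r \<subseteq> walk_ball (E \<inter> T \<times> T) v r"
    unfolding walk_ball_def by blast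
qed

text \<open>At most \<open>D ^ i\<close> nodes end a walk of length \<open>i\<close>. This caps the
  size of the patterns in the final linear combination.\<close>

lemma card_walk_ball:
  assumes "\<And>v. finite (E `` {v})" "\<And>v. card (E `` {v}) \<le> D"
  shows "finite (walk_ball E v r)" "card (walk_ball E v r) \<le> (\<Sum>i\<le>r. D ^ i)"
proof -
  have step: "finite ((E ^^ i) `` {v}) \<and> card ((E ^^ i) `` {v}) \<le> D ^ i" for i
  proof (induction i)
    case (Suc i)
    have eq: "(E ^^ Suc i) `` {v} = (\<Union>u\<in>(E ^^ i) `` {v}. E `` {u})" by auto
    have "card (\<Union>u\<in>(E ^^ i) `` {v}. E `` {u}) \<le> (\<Sum>u\<in>(E ^^ i) `` {v}. card (E `` {u}))"
      using Suc by (intro card_UN_le) blast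
    also have "\<dots> \<le> card ((E ^^ i) `` {v}) * D"
      using sum_bounded_above[of "(E ^^ i) `` {v}" "\<lambda>u. card (E `` {u})" D] assms(2) by simp
    also have "\<dots> \<le> D ^ i * D" using Suc by (intro mult_right_mono) auto
    finally show ?case unfolding eq using Suc assms(1) by (simp add: mult.commute)
  qed simp
  then show "finite (walk_ball E v r)" unfolding walk_ball_conv_Image by blast
  have "card (\<Union>i\<le>r. (E ^^ i) `` {v}) \<le> (\<Sum>i\<le>r. card ((E ^^ i) `` {v}))"
    by (rule card_UN_le) simp
  also have "\<dots> \<le> (\<Sum>i\<le>r. D ^ i)" by (rule sum_mono) (use step in blast)
  finally show "card (walk_ball E v r) \<le> (\<Sum>i\<le>r. D ^ i)" unfolding walk_ball_conv_Image .
qed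

lemma walk_ball_crossing:
  assumes "v \<in> A" "u \<in> walk_ball (E \<inter> S \<times> S) v r" "u \<notin> A"
  shows "\<exists>x\<in>A. \<exists>y\<in>S - A. (x, y) \<in> E"
proof -
  obtain i where "(v, u) \<in> (E \<inter> S \<times> S) ^^ i" using assms(2) unfolding walk_ball_def by blast
  then show ?thesis using assms(3)
  proof (induction i arbitrary: u)
    case 0
    then show ?case using assms(1) by simp
  next
    case (Suc i)
    from Suc.prems(1) obtain y where y: "(v, y) \<in> (E \<inter> S \<times> S) ^^ i" "(y, u) \<in> E \<inter> S \<times> S"
      by (rule relpow_Suc_E)
    show ?case
    proof (cases "y \<in> A")
      case True
      then show ?thesis using y(2) Suc.prems(2) by blast
    next
      case False
      then show ?thesis using Suc.IH[OF y(1)] by blast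
    qed
  qed
qed

section \<open>Agreement of walk balls with distance balls\<close>

lemma awalk_length_iff_relpow:
  assumes "pair_wf_digraph G" "u \<in> pverts G"
  shows "(\<exists>p. pre_digraph.awalk (with_proj G) u p w \<and> length p = i) \<longleftrightarrow> (u, w) \<in> parcs G ^^ i"
proof -
  interpret wf_digraph "with_proj G" using assms(1) by (simp add: wf_digraph_wp_iff)
  show ?thesis using assms(2)
  proof (induction i arbitrary: u)
    case 0
    then show ?case by (auto simp: awalk_Nil_iff)
  next
    case (Suc i)
    have in_V: "snd e \<in> pverts G" if "e \<in> parcs G" for e
      using assms(1) that by (rule pair_wf_digraph.arc_snd_in_verts)
    show ?case
    proof
      assume "\<exists>p. awalk u p w \<and> length p = Suc i"
      then obtain e p where p: "awalk u (e # p) w" "length p = i"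
        by (metis length_Suc_conv)
      then have e: "e \<in> parcs G" "u = fst e" "awalk (snd e) p w"
        by (auto simp: awalk_Cons_iff)
      then have "(snd e, w) \<in> parcs G ^^ i" using Suc.IH[OF in_V[OF e(1)]] p(2) by blast
      moreover have "(u, snd e) \<in> parcs G" using e by simp
      ultimately show "(u, w) \<in> parcs G ^^ Suc i" by (rule relpow_Suc_I2[rotated])
    next
      assume "(u, w) \<in> parcs G ^^ Suc i"
      then obtain y where y: "(u, y) \<in> parcs G" "(y, w) \<in> parcs G ^^ i" by (rule relpow_Suc_E2)
      then obtain p where "awalk y p w" "length p = i" using Suc.IH[of y] in_V[OF y(1)] by auto
      then have "awalk u ((u, y) # p) w \<and> length ((u, y) # p) = Suc i"
        using y(1) by (simp add: awalk_Cons_iff)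
      then show "\<exists>p. awalk u p w \<and> length p = Suc i" by blast
    qed
  qed
qed

lemma ball_verts_eq_walk_ball:
  assumes "pair_wf_digraph G" "v \<in> pverts G"
  shows "ball_verts G v r = walk_ball (parcs G) v r"
proof -
  interpret wf_digraph "with_proj G" using assms(1) by (simp add: wf_digraph_wp_iff)
  have cost: "awalk_cost (\<lambda>_. 1) p = length p" for p :: "('a \<times> 'a) list"
    by (induction p) auto
  have "graph_dist G v u \<le> ereal (real r) \<longleftrightarrow> (\<exists>p. awalk v p u \<and> length p \<le> r)" for u
  proof
    assume "graph_dist G v u \<le> ereal (real r)"
    \<comment> \<open>A strict bound on the infimum yields an actual walk; its length is an integer
      below \<open>r + 1\<close>, hence at most \<open>r\<close>.\<close>
    also have "\<dots> < ereal (real r + 1)" by simp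
    finally obtain p where "awalk v p u" "ereal (awalk_cost (\<lambda>_. 1) p) < ereal (real r + 1)"
      unfolding graph_dist_def \<mu>_def INF_less_iff by blast
    then show "\<exists>p. awalk v p u \<and> length p \<le> r" by (auto simp: cost)
  next
    assume "\<exists>p. awalk v p u \<and> length p \<le> r"
    then obtain p where p: "awalk v p u" "length p \<le> r" by blast
    have "graph_dist G v u \<le> ereal (awalk_cost (\<lambda>_. 1) p)"
      unfolding graph_dist_def by (rule min_cost_le_walk_cost[OF p(1)])
    then show "graph_dist G v u \<le> ereal (real r)"
      using p(2) by (simp add: cost) (meson ereal_less_eq(3) of_nat_le_iff order_trans)
  qed
  moreover have "u \<in> pverts G" if "awalk v p u" for p u
    using awalk_last_in_verts[OF that] by simp
  ultimately have "ball_verts G v r = {u. \<exists>p. awalk v p u \<and> length p \<le> r}"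
    unfolding ball_verts_def by blast
  also have "\<dots> = {u. \<exists>i\<le>r. \<exists>p. awalk v p u \<and> length p = i}"
    by auto
  finally show ?thesis
    unfolding walk_ball_def awalk_length_iff_relpow[OF assms] .
qed

text \<open>The ball is taken inside \<open>T\<close> so that the condition can be inverted over
  \<open>T\<close>. Requiring \<open>v \<in> T\<close> makes all terms with a root outside
  \<open>S\<close> vanish.\<close>

definition ball_matches ::
  "'b pair_pre_digraph \<Rightarrow> 'b \<Rightarrow> nat \<Rightarrow> ('a \<times> 'a) set \<Rightarrow> 'a set \<Rightarrow> 'a \<Rightarrow> bool" where
  "ball_matches U w r E T v \<longleftrightarrow> v \<in> T \<and>
    (\<exists>f. bij_betw f (walk_ball (E \<inter> T \<times> T) v r) (pverts U) \<and> f v = w \<and>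
      (\<forall>x\<in>walk_ball (E \<inter> T \<times> T) v r. \<forall>y\<in>walk_ball (E \<inter> T \<times> T) v r.
        (x, y) \<in> E \<longleftrightarrow> (f x, f y) \<in> parcs U))"

lemma rooted_iso_ball_iff:
  assumes "pair_wf_digraph G" "v \<in> pverts G"
  shows "rooted_iso (graph_ball G v r) v U w \<longleftrightarrow> ball_matches U w r (parcs G) (pverts G) v"
proof -
  have "parcs G \<inter> pverts G \<times> pverts G = parcs G"
    using pair_wf_digraph.arc_fst_in_verts[OF assms(1)] pair_wf_digraph.arc_snd_in_verts[OF assms(1)]
    by force
  then show ?thesis
    unfolding rooted_iso_def ball_matches_def graph_ball_def ball_verts_eq_walk_ball[OF assms]
    using assms(2) by simp
qed

section \<open>Invariance of ball matching under isomorphism\<close>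

lemma restricted_Image_image:
  assumes iso: "\<And>x y. x \<in> T \<Longrightarrow> y \<in> T \<Longrightarrow> (x, y) \<in> E \<longleftrightarrow> (h x, h y) \<in> E'" and B: "B \<subseteq> T"
  shows "(E' \<inter> h ` T \<times> h ` T) `` (h ` B) = h ` ((E \<inter> T \<times> T) `` B)"
proof (intro set_eqI iffI)
  fix a assume "a \<in> (E' \<inter> h ` T \<times> h ` T) `` (h ` B)"
  then obtain b where b: "b \<in> B" "(h b, a) \<in> E' \<inter> h ` T \<times> h ` T"
    by (elim ImageE imageE) simp
  then obtain c where c: "c \<in> T" "a = h c" by (elim IntE SigmaE2 imageE)
  have "b \<in> T" using b(1) B by (rule rev_subsetD)
  then have "(b, c) \<in> E \<inter> T \<times> T" using iso b(2) c by simp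
  then show "a \<in> h ` ((E \<inter> T \<times> T) `` B)" using b(1) c(2) by (intro image_eqI ImageI)
next
  fix a assume "a \<in> h ` ((E \<inter> T \<times> T) `` B)"
  then obtain b c where bc: "b \<in> B" "(b, c) \<in> E \<inter> T \<times> T" "a = h c"
    by (elim ImageE imageE) blast
  then have "(h b, h c) \<in> E' \<inter> h ` T \<times> h ` T" using iso[of b c] by simp
  then show "a \<in> (E' \<inter> h ` T \<times> h ` T) `` (h ` B)" using bc by (intro ImageI[of "h b"]) simp_all
qed

lemma walk_ball_image:
  assumes iso: "\<And>x y. x \<in> T \<Longrightarrow> y \<in> T \<Longrightarrow> (x, y) \<in> E \<longleftrightarrow> (h x, h y) \<in> E'"
    and v: "v \<in> T"
  shows "walk_ball (E' \<inter> h ` T \<times> h ` T) (h v) r = h ` walk_ball (E \<inter> T \<times> T) v r"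
proof -
  let ?R = "E \<inter> T \<times> T" and ?R' = "E' \<inter> h ` T \<times> h ` T"
  have "(?R' ^^ i) `` {h v} = h ` ((?R ^^ i) `` {v}) \<and> (?R ^^ i) `` {v} \<subseteq> T" for i
  proof (induction i)
    case 0
    then show ?case using v by simp
  next
    case (Suc i)
    have "?R' `` ((?R' ^^ i) `` {h v}) = h ` (?R `` ((?R ^^ i) `` {v}))"
      using Suc restricted_Image_image[OF iso] by simp
    moreover have "?R `` ((?R ^^ i) `` {v}) \<subseteq> T" by blast
    ultimately show ?case by (simp add: relcomp_Image)
  qed
  then show ?thesis unfolding walk_ball_conv_Image image_UN by simp
qed

lemma ball_matches_if_image:
  assumes h: "inj_on h T" and iso: "\<And>x y. x \<in> T \<Longrightarrow> y \<in> T \<Longrightarrow> (x, y) \<in> E \<longleftrightarrow> (h x, h y) \<in> E'"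
    and v: "v \<in> T" and m: "ball_matches U w r E' (h ` T) (h v)"
  shows "ball_matches U w r E T v"
proof -
  let ?B = "walk_ball (E \<inter> T \<times> T) v r"
  have eq: "walk_ball (E' \<inter> h ` T \<times> h ` T) (h v) r = h ` ?B"
    by (rule walk_ball_image[OF iso v])
  have sub: "?B \<subseteq> T" by (rule walk_ball_subset[OF v])
  obtain f where f: "bij_betw f (h ` ?B) (pverts U)" "f (h v) = w"
    "\<forall>x\<in>h ` ?B. \<forall>y\<in>h ` ?B. (x, y) \<in> E' \<longleftrightarrow> (f x, f y) \<in> parcs U"
    using m unfolding ball_matches_def eq by blast
  have "bij_betw h ?B (h ` ?B)" using inj_on_subset[OF h sub] by (rule inj_on_imp_bij_betw)
  then have "bij_betw (f \<circ> h) ?B (pverts U)" using f(1) by (rule bij_betw_trans)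
  moreover have "(x, y) \<in> E \<longleftrightarrow> ((f \<circ> h) x, (f \<circ> h) y) \<in> parcs U" if "x \<in> ?B" "y \<in> ?B" for x y
  proof -
    have "x \<in> T" "y \<in> T" using that sub by blast+
    then show ?thesis using f(3) iso that by simp
  qed
  ultimately show ?thesis
    unfolding ball_matches_def using v f(2) by (intro conjI exI[of _ "f \<circ> h"]) auto
qed

lemma ball_matches_image:
  assumes h: "inj_on h T" and iso: "\<And>x y. x \<in> T \<Longrightarrow> y \<in> T \<Longrightarrow> (x, y) \<in> E \<longleftrightarrow> (h x, h y) \<in> E'"
    and v: "v \<in> T"
  shows "ball_matches U w r E' (h ` T) (h v) \<longleftrightarrow> ball_matches U w r E T v"
proof
  assume "ball_matches U w r E T v"
  moreover have "inv_into T h ` h ` T = T" "inv_into T h (h v) = v"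
    using h v by (simp_all add: inv_into_image_cancel)
  ultimately have "ball_matches U w r E (inv_into T h ` h ` T) (inv_into T h (h v))" by simp
  then show "ball_matches U w r E' (h ` T) (h v)"
  proof (rule ball_matches_if_image[rotated -1])
    show "inj_on (inv_into T h) (h ` T)" by (rule inj_on_inv_into) simp
    show "(a, b) \<in> E' \<longleftrightarrow> (inv_into T h a, inv_into T h b) \<in> E" if "a \<in> h ` T" "b \<in> h ` T" for a b
      using that iso h by auto
  qed (use v in simp)
qed (rule ball_matches_if_image[OF h iso v])

text \<open>
  Moebius inversion over the node sets \<open>T \<subseteq> S\<close> of whether the ball inside \<open>T\<close> matches: nodes of \<open>S\<close>
  out of reach of the root do not affect the ball, so only sets \<open>S\<close> that are themselves balls contribute.
\<close>

definition ball_weight ::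
  "'b pair_pre_digraph \<Rightarrow> 'b \<Rightarrow> nat \<Rightarrow> ('a \<times> 'a) set \<Rightarrow> 'a set \<Rightarrow> complex" where
  "ball_weight U w r E S = (\<Sum>v\<in>S. mobius (\<lambda>T. of_bool (ball_matches U w r E T v)) S)"

text \<open>Inversion at \<open>V\<close> for each root, followed by an exchange of sums. For a root
  outside \<open>S\<close> all terms of the Moebius sum at \<open>S\<close> are 0, so the roots may
  be restricted to \<open>S\<close>.\<close>

lemma card_ball_matches:
  assumes "finite V"
  shows "of_nat (card {v \<in> V. ball_matches U w r E V v}) = (\<Sum>S\<in>Pow V. ball_weight U w r E S)"
proof -
  have "of_nat (card {v \<in> V. ball_matches U w r E V v}) =
      (\<Sum>v\<in>V. of_bool (ball_matches U w r E V v) :: complex)"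
    using assms by (simp add: sum.If_cases of_bool_def Int_def)
  also have "\<dots> = (\<Sum>v\<in>V. \<Sum>S\<in>Pow V. mobius (\<lambda>T. of_bool (ball_matches U w r E T v)) S)"
    by (simp add: sum_Pow_mobius assms)
  also have "\<dots> = (\<Sum>S\<in>Pow V. \<Sum>v\<in>V. mobius (\<lambda>T. of_bool (ball_matches U w r E T v)) S)"
    by (rule sum.swap)
  also have "\<dots> = (\<Sum>S\<in>Pow V. ball_weight U w r E S)"
    unfolding ball_weight_def
  proof (rule sum.cong[OF refl])
    fix S assume S: "S \<in> Pow V"
    show "(\<Sum>v\<in>V. mobius (\<lambda>T. of_bool (ball_matches U w r E T v)) S) =
        (\<Sum>v\<in>S. mobius (\<lambda>T. of_bool (ball_matches U w r E T v)) S :: complex)"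
    proof (rule sum.mono_neutral_right[OF assms]; (intro ballI)?)
      fix v assume "v \<in> V - S"
      then have "mobius (\<lambda>T. of_bool (ball_matches U w r E T v)) S = mobius (\<lambda>T. 0) S"
        using S by (intro mobius_cong) (auto simp: ball_matches_def)
      then show "mobius (\<lambda>T. of_bool (ball_matches U w r E T v)) S = 0" by (simp add: mobius_def)
    qed (use S in simp)
  qed
  finally show ?thesis .
qed

lemma ball_weight_nonzero:
  assumes "finite S" "ball_weight U w r E S \<noteq> 0"
  obtains v where "v \<in> S" "S \<subseteq> walk_ball (E \<inter> S \<times> S) v r"
proof -
  obtain v where v: "v \<in> S" "mobius (\<lambda>T. of_bool (ball_matches U w r E T v)) S \<noteq> (0 :: complex)"
    using assms(2) unfolding ball_weight_def by (rule sum.not_neutral_contains_not_neutral)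
  have "S \<subseteq> walk_ball (E \<inter> S \<times> S) v r"
  proof (rule ccontr)
    assume "\<not> S \<subseteq> walk_ball (E \<inter> S \<times> S) v r"
    then obtain u where u: "u \<in> S" "u \<notin> walk_ball (E \<inter> S \<times> S) v r" by blast
    have "v \<noteq> u" using u(2) centre_in_walk_ball by metis
    have "mobius (\<lambda>T. of_bool (ball_matches U w r E T v)) S = (0 :: complex)"
    proof (rule mobius_eq_0[OF assms(1) u(1)])
      fix T assume "T \<subseteq> S - {u}"
      then have "insert u T \<subseteq> S" using u(1) by blast
      from walk_ball_insert[OF u(2) this]
      have "ball_matches U w r E (insert u T) v = ball_matches U w r E T v"
        unfolding ball_matches_def using \<open>v \<noteq> u\<close> by simp
      then show "of_bool (ball_matches U w r E (insert u T) v) = (of_bool (ball_matches U w r E T v) :: complex)"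
        by simp
    qed
    then show False using v(2) by contradiction
  qed
  then show thesis using v(1) that by blast
qed

text \<open>Invariance under isomorphism allows the weight of \<open>S\<close> to be computed on a
  labelled copy with nodes \<open>{..<k}\<close>.\<close>

lemma ball_weight_image:
  assumes h: "inj_on h S" and iso: "\<And>x y. x \<in> S \<Longrightarrow> y \<in> S \<Longrightarrow> (x, y) \<in> E \<longleftrightarrow> (h x, h y) \<in> E'"
  shows "ball_weight U w r E' (h ` S) = ball_weight U w r E S"
proof -
  have "ball_weight U w r E' (h ` S) = (\<Sum>v\<in>S. mobius (\<lambda>T. of_bool (ball_matches U w r E' T (h v))) (h ` S))"
    unfolding ball_weight_def by (simp add: sum.reindex[OF h])
  also have "\<dots> = (\<Sum>v\<in>S. mobius (\<lambda>T. of_bool (ball_matches U w r E T v)) S)"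
  proof (intro sum.cong refl mobius_image h)
    fix v T assume v: "v \<in> S" and T: "T \<subseteq> S"
    have hT: "inj_on h T" using h T by (rule inj_on_subset)
    have "ball_matches U w r E' (h ` T) (h v) = ball_matches U w r E T v"
    proof (cases "v \<in> T")
      case True
      show ?thesis by (rule ball_matches_image[OF hT _ True]) (use iso T in blast)
    next
      case False
      then have "h v \<notin> h ` T" using h v T by (auto dest: inj_onD)
      then show ?thesis using False unfolding ball_matches_def by simp
    qed
    then show "of_bool (ball_matches U w r E' (h ` T) (h v)) = (of_bool (ball_matches U w r E T v) :: complex)"
      by simp
  qed
  finally show ?thesis unfolding ball_weight_def .
qed


section \<open>Ball counts from induced subgraph counts\<close>

definition node_pairs :: "nat \<Rightarrow> nat set set" where
  "node_pairs k = {{a, b} | a b. a < k \<and> b < k \<and> a \<noteq> b}"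

definition arcs_of :: "'c set set \<Rightarrow> ('c \<times> 'c) set" where
  "arcs_of F = {(a, b). a \<noteq> b \<and> {a, b} \<in> F}"

lemma finite_node_pairs: "finite (node_pairs k)"
proof -
  have "node_pairs k \<subseteq> Pow {..<k}" unfolding node_pairs_def by auto
  then show ?thesis by (rule finite_subset) simp
qed

text \<open>Equal cardinalities make an onto map bijective. Its edge image is exactly
  \<open>F\<close>, so non-edges are preserved as well.\<close>

lemma onto_homs_iso:
  assumes "finite S" "card S = card W" "finite W" "sym E" "\<And>x. (x, x) \<notin> E"
    and \<phi>: "\<phi> \<in> onto_homs E (W <+> F) S"
  shows "inj_on \<phi> S" "\<phi> ` S = W" "\<And>x y. x \<in> S \<Longrightarrow> y \<in> S \<Longrightarrow> (x, y) \<in> E \<longleftrightarrow> (\<phi> x, \<phi> y) \<in> arcs_of F"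
proof -
  have "\<phi> ` S <+> edge_image E \<phi> S = W <+> F"
    using \<phi> unfolding onto_homs_def hom_image_def by simp
  then have img: "\<phi> ` S = W" and edges: "edge_image E \<phi> S = F" by (auto simp: Plus_def)
  show "\<phi> ` S = W" by fact
  show inj: "inj_on \<phi> S" using img assms by (intro eq_card_imp_inj_on) auto
  fix x y assume xy: "x \<in> S" "y \<in> S"
  show "(x, y) \<in> E \<longleftrightarrow> (\<phi> x, \<phi> y) \<in> arcs_of F"
  proof
    assume E: "(x, y) \<in> E"
    then have "x \<noteq> y" using assms(5) by blast
    then have ne: "\<phi> x \<noteq> \<phi> y" using inj xy by (simp add: inj_on_eq_iff)
    then have "{\<phi> x, \<phi> y} \<in> edge_image E \<phi> S"
      unfolding edge_image_def mem_Collect_eq using E xy by (intro exI[of _ x] exI[of _ y]) simp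
    then show "(\<phi> x, \<phi> y) \<in> arcs_of F" using ne edges unfolding arcs_of_def by simp
  next
    assume "(\<phi> x, \<phi> y) \<in> arcs_of F"
    then have "{\<phi> x, \<phi> y} \<in> edge_image E \<phi> S" using edges unfolding arcs_of_def by simp
    then obtain a b where ab: "{\<phi> x, \<phi> y} = {\<phi> a, \<phi> b}" "a \<in> S" "b \<in> S" "(a, b) \<in> E"
      unfolding edge_image_def by blast
    then consider "\<phi> x = \<phi> a" "\<phi> y = \<phi> b" | "\<phi> x = \<phi> b" "\<phi> y = \<phi> a"
      by (auto simp: doubleton_eq_iff)
    then show "(x, y) \<in> E"
    proof cases
      case 1
      then have "x = a" "y = b" using inj xy ab(2,3) by (simp_all add: inj_on_eq_iff)
      then show ?thesis using ab(4) by simp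
    next
      case 2
      then have "x = b" "y = a" using inj xy ab(2,3) by (simp_all add: inj_on_eq_iff)
      then show ?thesis using ab(4) assms(4) by (simp add: symD)
    qed
  qed
qed

text \<open>Each bijection from \<open>S\<close> to \<open>{..<k}\<close> is onto exactly one
  labelled graph. The right side is k!, in the falling form in which injections are counted.\<close>

lemma sum_card_onto_homs:
  assumes "finite S" "card S = k"
  shows "(\<Sum>F\<in>Pow (node_pairs k). card (onto_homs E ({..<k} <+> F) S)) = prod ((-) k) {0..<k}"
proof -
  let ?A = "{\<phi> \<in> S \<rightarrow>\<^sub>E {..<k}. inj_on \<phi> S}"
  have fin: "finite ?A" using assms(1) by (simp add: finite_PiE)
  have surj: "\<phi> ` S = {..<k} \<longleftrightarrow> inj_on \<phi> S" if "\<phi> \<in> S \<rightarrow>\<^sub>E {..<k}" for \<phi>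
  proof
    assume "\<phi> ` S = {..<k}"
    then show "inj_on \<phi> S" using assms by (intro eq_card_imp_inj_on) auto
  next
    assume "inj_on \<phi> S"
    then have "card (\<phi> ` S) = card {..<k}" using assms by (simp add: card_image)
    moreover have "\<phi> ` S \<subseteq> {..<k}" using that by auto
    ultimately show "\<phi> ` S = {..<k}" by (intro card_subset_eq) auto
  qed
  have edges: "edge_image E \<phi> S \<in> Pow (node_pairs k)" if "\<phi> \<in> ?A" for \<phi>
  proof
    show "edge_image E \<phi> S \<subseteq> node_pairs k"
    proof
      fix e assume "e \<in> edge_image E \<phi> S"
      then obtain x y where xy: "e = {\<phi> x, \<phi> y}" "x \<in> S" "y \<in> S" "\<phi> x \<noteq> \<phi> y"
        unfolding edge_image_def by blast
      then have "\<phi> x < k" "\<phi> y < k" using that by auto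
      then show "e \<in> node_pairs k" unfolding node_pairs_def using xy by blast
    qed
  qed
  have eq: "onto_homs E ({..<k} <+> F) S = {\<phi> \<in> ?A. edge_image E \<phi> S = F}" for F
  proof -
    have nodes: "Inl -` ({..<k} <+> F) = {..<k}" by auto
    have plus: "\<phi> ` S <+> edge_image E \<phi> S = {..<k} <+> F \<longleftrightarrow> \<phi> ` S = {..<k} \<and> edge_image E \<phi> S = F" for \<phi>
      by (auto simp: Plus_def)
    show ?thesis
      unfolding onto_homs_def hom_image_def nodes plus using surj by blast
  qed
  have "card ?A = (\<Sum>\<phi>\<in>?A. 1)" by simp
  also have "\<dots> = (\<Sum>F\<in>Pow (node_pairs k). \<Sum>\<phi> | \<phi> \<in> ?A \<and> edge_image E \<phi> S = F. 1)"
    by (rule sum.group[symmetric]) (use fin edges finite_node_pairs in auto)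
  finally have "card ?A = (\<Sum>F\<in>Pow (node_pairs k). card (onto_homs E ({..<k} <+> F) S))"
    unfolding eq by simp
  then show ?thesis
    using card_inj_on_subset_funcset[of S "{..<k}" S] assms by simp
qed

text \<open>Averaging over all k! labellings: whenever the count for \<open>F\<close> is nonzero,
  \<open>F\<close> is a labelled copy of the graph on \<open>S\<close> and has the same
  weight.\<close>

lemma ball_weight_expand:
  assumes "finite S" "card S = k" "sym E" "\<And>x. (x, x) \<notin> E"
  shows "of_nat (prod ((-) k) {0..<k}) * ball_weight U w r E S =
    (\<Sum>F\<in>Pow (node_pairs k). of_nat (card (onto_homs E ({..<k} <+> F) S)) * ball_weight U w r (arcs_of F) {..<k})"
proof -
  have eq: "of_nat (card (onto_homs E ({..<k} <+> F) S)) * ball_weight U w r E S =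
      of_nat (card (onto_homs E ({..<k} <+> F) S)) * ball_weight U w r (arcs_of F) {..<k}" for F
  proof (cases "onto_homs E ({..<k} <+> F) S = {}")
    case False
    then obtain \<phi> where \<phi>: "\<phi> \<in> onto_homs E ({..<k} <+> F) S" by blast
    have c: "card S = card {..<k}" using assms by simp
    note iso = onto_homs_iso[OF assms(1) c finite_lessThan assms(3,4) \<phi>]
    have "ball_weight U w r (arcs_of F) (\<phi> ` S) = ball_weight U w r E S"
      by (rule ball_weight_image[OF iso(1)]) (rule iso(3))
    then show ?thesis using iso(2) by simp
  qed simp
  show ?thesis
    unfolding sum_card_onto_homs[OF assms(1,2), of E, symmetric] of_nat_sum sum_distrib_right
    by (rule sum.cong[OF refl eq])
qed

text \<open>A nonzero weight provides a root that reaches all nodes, so every cut is crossed. Hence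
  only connected graphs, the ones whose counts are known to converge, enter the linear
  combination.\<close>

lemma connected_graph_if_ball_weight:
  fixes k :: nat
  assumes "ball_weight U w r (arcs_of F) {..<k} \<noteq> 0"
  shows "connected_graph {..<k} F" "k > 0"
proof -
  obtain v where v: "v \<in> {..<k}" "{..<k} \<subseteq> walk_ball (arcs_of F \<inter> {..<k} \<times> {..<k}) v r"
    using ball_weight_nonzero[OF finite_lessThan assms] by blast
  show "k > 0" using v(1) by auto
  show "connected_graph {..<k} F"
    unfolding connected_graph_def
  proof (intro allI impI)
    fix A assume A: "A \<subseteq> {..<k}" "A \<noteq> {}" "A \<noteq> {..<k}"
    have "\<exists>x\<in>A. \<exists>y\<in>{..<k} - A. (x, y) \<in> arcs_of F"
    proof (cases "v \<in> A")
      case True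
      obtain u where "u \<in> {..<k}" "u \<notin> A" using A by blast
      then show ?thesis using walk_ball_crossing[OF True, of u "arcs_of F" "{..<k}" r] v(2) by blast
    next
      case False
      \<comment> \<open>With the root outside \<open>A\<close>, a walk into \<open>A\<close> crosses
        the complementary cut, and the symmetry of \<open>arcs_of\<close> reverses the edge
        found.\<close>
      then have v': "v \<in> {..<k} - A" using v(1) by blast
      obtain u where u: "u \<in> A" using A(2) by blast
      then have "u \<in> walk_ball (arcs_of F \<inter> {..<k} \<times> {..<k}) v r" "u \<notin> {..<k} - A"
        using A(1) v(2) by blast+
      from walk_ball_crossing[OF v' this] obtain x y
        where xy: "x \<in> {..<k} - A" "y \<in> {..<k} - ({..<k} - A)" "(x, y) \<in> arcs_of F" by blast
      have "(y, x) \<in> arcs_of F" using xy(3) unfolding arcs_of_def by (simp add: insert_commute)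
      then show ?thesis using xy(1,2) by blast
    qed
    then show "\<exists>x\<in>A. \<exists>y\<in>{..<k} - A. {x, y} \<in> F" unfolding arcs_of_def by blast
  qed
qed

text \<open>The index ranges and coefficients depend on \<open>U\<close>, \<open>w\<close>,
  \<open>r\<close> and \<open>D\<close> alone. Sets of nonzero weight are contained in a ball, which
  bounds \<open>k\<close>.\<close>

lemma card_ball_matches_expand:
  assumes "finite V" "E \<subseteq> V \<times> V" "sym E" "\<And>x. (x, x) \<notin> E" "\<forall>v\<in>V. card (E `` {v}) \<le> D"
  shows "of_nat (card {v \<in> V. ball_matches U w r E V v}) =
    (\<Sum>k\<le>(\<Sum>i\<le>r. D ^ i). \<Sum>F\<in>Pow (node_pairs k).
      ball_weight U w r (arcs_of F) {..<k} / of_nat (prod ((-) k) {0..<k}) *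
      (\<Sum>S | S \<subseteq> V \<and> card S = k. of_nat (card (onto_homs E ({..<k} <+> F) S))))"
proof -
  let ?M = "\<Sum>i\<le>r. D ^ i"
  have finE: "finite (E `` {v})" for v
    using assms(1,2) by (intro finite_subset[of "E `` {v}" V]) auto
  have degE: "card (E `` {v}) \<le> D" for v
  proof (cases "v \<in> V")
    case False
    then have "E `` {v} = {}" using assms(2) by blast
    then show ?thesis by simp
  qed (use assms(5) in blast)
  have small: "card S \<le> ?M" if S: "S \<in> Pow V" "ball_weight U w r E S \<noteq> 0" for S
  proof -
    have "finite S" using S(1) assms(1) finite_subset by blast
    then obtain v where "S \<subseteq> walk_ball (E \<inter> S \<times> S) v r"
      using ball_weight_nonzero[OF _ S(2)] by blast
    also have "\<dots> \<subseteq> walk_ball E v r" by (rule walk_ball_mono) blast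
    finally have "card S \<le> card (walk_ball E v r)"
      using card_walk_ball(1)[OF finE degE] by (intro card_mono)
    also have "\<dots> \<le> ?M" by (rule card_walk_ball(2)[OF finE degE])
    finally show ?thesis .
  qed
  \<comment> \<open>The factors are \<open>k - i\<close> with \<open>i < k\<close>, none of which is
    zero.\<close>
  have pos: "(of_nat (prod ((-) k) {0..<k}) :: complex) \<noteq> 0" for k :: nat
    by (simp add: prod_zero_iff)
  have "of_nat (card {v \<in> V. ball_matches U w r E V v}) = (\<Sum>S\<in>Pow V. ball_weight U w r E S)"
    by (rule card_ball_matches[OF assms(1)])
  also have "\<dots> = (\<Sum>S | S \<subseteq> V \<and> card S \<le> ?M. ball_weight U w r E S)"
    using assms(1) small by (intro sum.mono_neutral_right) auto
  also have "\<dots> = (\<Sum>k\<le>?M. \<Sum>S\<in>{S \<in> {S. S \<subseteq> V \<and> card S \<le> ?M}. card S = k}. ball_weight U w r E S)"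
    using assms(1) by (intro sum.group[symmetric]) auto
  also have "\<dots> = (\<Sum>k\<le>?M. \<Sum>S | S \<subseteq> V \<and> card S = k. ball_weight U w r E S)"
    by (intro sum.cong) auto
  also have "\<dots> = (\<Sum>k\<le>?M. \<Sum>S | S \<subseteq> V \<and> card S = k. \<Sum>F\<in>Pow (node_pairs k).
      ball_weight U w r (arcs_of F) {..<k} / of_nat (prod ((-) k) {0..<k}) *
      of_nat (card (onto_homs E ({..<k} <+> F) S)))"
  proof (rule sum.cong[OF refl], rule sum.cong[OF refl])
    fix k S assume "S \<in> {S. S \<subseteq> V \<and> card S = k}"
    then have S: "finite S" "card S = k" using assms(1) finite_subset by auto
    have "ball_weight U w r E S = of_nat (prod ((-) k) {0..<k}) * ball_weight U w r E S / of_nat (prod ((-) k) {0..<k})"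
      using pos[of k] by (simp del: of_nat_prod)
    also have "\<dots> = (\<Sum>F\<in>Pow (node_pairs k). of_nat (card (onto_homs E ({..<k} <+> F) S)) *
        ball_weight U w r (arcs_of F) {..<k}) / of_nat (prod ((-) k) {0..<k})"
      unfolding ball_weight_expand[OF S assms(3,4)] ..
    finally show "ball_weight U w r E S = (\<Sum>F\<in>Pow (node_pairs k).
        ball_weight U w r (arcs_of F) {..<k} / of_nat (prod ((-) k) {0..<k}) *
        of_nat (card (onto_homs E ({..<k} <+> F) S)))"
      by (simp add: sum_divide_distrib mult.commute del: of_nat_prod)
  qed
  also have "\<dots> = (\<Sum>k\<le>?M. \<Sum>F\<in>Pow (node_pairs k).
      ball_weight U w r (arcs_of F) {..<k} / of_nat (prod ((-) k) {0..<k}) *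
      (\<Sum>S | S \<subseteq> V \<and> card S = k. of_nat (card (onto_homs E ({..<k} <+> F) S))))"
    by (subst sum.swap) (simp add: sum_distrib_left del: of_nat_prod)
  finally show ?thesis .
qed

theorem theorem4p3:
  fixes D :: nat and G :: "nat \<Rightarrow> 'a pair_pre_digraph"
  assumes "D \<ge> 1"
    and "\<And>n. pair_graph (G n)"
    and "\<And>n. pverts (G n) \<noteq> {}"
    and "\<And>n v. v \<in> pverts (G n) \<Longrightarrow> out_degree (with_proj (G n)) v \<le> D"
    and "\<exists>\<delta>::real. \<delta> > 0 \<and>
      (\<forall>H :: nat pair_pre_digraph.
        simple_looped_graph H \<and> pverts H \<noteq> {} \<and>
        (\<forall>v \<in> pverts H.
          real (out_degree (with_proj H) v) \<ge> (1 - \<delta>) * real (card (pverts H))) \<longrightarrow>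
        convergent (\<lambda>n. ln (real (hom_count (G n) H)) / real (card (pverts (G n)))))"
  shows "left_convergent G"
  unfolding left_convergent_def
proof (intro allI impI)
  fix r :: nat and U :: "nat pair_pre_digraph" and w
  let ?V = "\<lambda>n. pverts (G n)" and ?E = "\<lambda>n. parcs (G n)"
  obtain \<delta> :: real where \<delta>: "\<delta> > 0" "\<And>H :: nat pair_pre_digraph.
        simple_looped_graph H \<Longrightarrow> pverts H \<noteq> {} \<Longrightarrow>
        (\<forall>v \<in> pverts H. real (out_degree (with_proj H) v) \<ge> (1 - \<delta>) * real (card (pverts H))) \<Longrightarrow>
        convergent (\<lambda>n. ln (real (hom_count (G n) H)) / real (card (pverts (G n))))"
    using assms(5) by blast
  note G = pair_graph_parcs[OF assms(2)]
  have deg: "\<forall>v\<in>?V n. card (?E n `` {v}) \<le> D" for n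
    using assms(4) by (simp add: out_degree_eq_card_Image)
  have wf: "pair_wf_digraph (G n)" for n
    using assms(2)[of n] by (simp add: pair_graph_def pair_digraph_def pair_fin_digraph_def)
  have conv: "convergent (\<lambda>n. (\<Sum>S | S \<subseteq> ?V n \<and> card S = k.
      of_nat (card (onto_homs (?E n) ({..<k} <+> F) S))) / complex_of_nat (card (?V n)))"
    if F: "F \<subseteq> node_pairs k" "connected_graph {..<k} F" "k > 0" for k F
  proof -
    \<comment> \<open>Graphs with \<open>k\<close> nodes sit at index \<open>k - 1\<close> of the
      logarithmic derivative, with an extra factor \<open>k\<close> that is divided out.\<close>
    obtain m where k: "k = Suc m" using F(3) by (cases k) auto
    let ?Y = "{..<k} <+> F"
    have finF: "finite F" using F(1) finite_node_pairs by (rule finite_subset)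
    have finY: "finite ?Y" using finF by simp
    have "convergent (\<lambda>n. mobius (\<lambda>Y. fps_nth (log_deriv_series (?E n) (?V n) Y) m / of_nat (card (?V n))) ?Y / of_nat k)"
      unfolding mobius_def divide_inverse[of "sum _ _"]
    proof (intro convergent_mult convergent_sum convergent_const)
      fix Y assume "Y \<in> Pow ?Y"
      then have "finite Y" using finY finite_subset by blast
      then show "convergent (\<lambda>n. fps_nth (log_deriv_series (?E n) (?V n) Y) m / of_nat (card (?V n)))"
        using log_deriv_series_convergent[of G D \<delta> Y m] assms(2-4) \<delta> by blast
    qed
    moreover have "mobius (\<lambda>Y. fps_nth (log_deriv_series (?E n) (?V n) Y) m / of_nat (card (?V n))) ?Y / of_nat k =
        (\<Sum>S | S \<subseteq> ?V n \<and> card S = k. of_nat (card (onto_homs (?E n) ?Y S))) / of_nat (card (?V n))" for n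
    proof -
      have "mobius (\<lambda>Y. fps_nth (log_deriv_series (?E n) (?V n) Y) m / of_nat (card (?V n))) ?Y =
          inverse (of_nat (card (?V n))) * mobius (\<lambda>Y. fps_nth (log_deriv_series (?E n) (?V n) Y) m) ?Y"
        unfolding mobius_cmult[symmetric] by (simp add: field_simps)
      also have "mobius (\<lambda>Y. fps_nth (log_deriv_series (?E n) (?V n) Y) m) ?Y =
          of_nat k * (\<Sum>S | S \<subseteq> ?V n \<and> card S = k. of_nat (card (onto_homs (?E n) ?Y S)))"
        using mobius_log_deriv_series[OF G(1) finite_lessThan finF F(2), of m "?E n"] k by simp
      finally show ?thesis using F(3) by (simp add: field_simps)
    qed
    ultimately show ?thesis by simp
  qed
  define N where "N n k F = (\<Sum>S | S \<subseteq> ?V n \<and> card S = k.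
      complex_of_nat (card (onto_homs (?E n) ({..<k} <+> F) S)))" for n k and F :: "nat set set"
  define c where "c k F = ball_weight U w r (arcs_of F) {..<k} / of_nat (prod ((-) k) {0..<k})"
    for k :: nat and F
  have "complex_of_nat (card {v \<in> ?V n. ball_matches U w r (?E n) (?V n) v}) / of_nat (card (?V n)) =
      (\<Sum>k\<le>(\<Sum>i\<le>r. D ^ i). \<Sum>F\<in>Pow (node_pairs k). c k F * (N n k F / of_nat (card (?V n))))" for n
    unfolding card_ball_matches_expand[OF G deg] N_def[symmetric] c_def[symmetric]
    by (simp add: sum_divide_distrib)
  moreover have "convergent (\<lambda>n. \<Sum>k\<le>(\<Sum>i\<le>r. D ^ i). \<Sum>F\<in>Pow (node_pairs k).
      c k F * (N n k F / of_nat (card (?V n))))"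
  proof (intro convergent_sum)
    fix k F assume F: "F \<in> Pow (node_pairs k)"
    show "convergent (\<lambda>n. c k F * (N n k F / of_nat (card (?V n))))"
    \<comment> \<open>Counts of disconnected graphs need not converge on the scale of |G|, but their
      coefficient is zero.\<close>
    proof (cases "ball_weight U w r (arcs_of F) {..<k} = 0")
      case True
      then show ?thesis by (simp add: c_def convergent_const)
    next
      case False
      then have "convergent (\<lambda>n. N n k F / of_nat (card (?V n)))"
        unfolding N_def using conv[of F k] connected_graph_if_ball_weight[OF False] F by simp
      then show ?thesis by (intro convergent_mult convergent_const)
    qed
  qed
  moreover have "complex_of_nat (card {v \<in> ?V n. ball_matches U w r (?E n) (?V n) v}) / of_nat (card (?V n)) =
      complex_of_real (ball_frequency (G n) r U w)" for n
  proof -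
    have "{v \<in> ?V n. rooted_iso (graph_ball (G n) v r) v U w} = {v \<in> ?V n. ball_matches U w r (?E n) (?V n) v}"
      by (intro Collect_cong conj_cong refl rooted_iso_ball_iff[OF wf])
    then show ?thesis unfolding ball_frequency_def by simp
  qed
  ultimately have "convergent (\<lambda>n. complex_of_real (ball_frequency (G n) r U w))" by simp
  then obtain l where "(\<lambda>n. complex_of_real (ball_frequency (G n) r U w)) \<longlonglongrightarrow> l"
    unfolding convergent_def by blast
  then have "(\<lambda>n. Re (complex_of_real (ball_frequency (G n) r U w))) \<longlonglongrightarrow> Re l" by (rule tendsto_Re)
  then show "convergent (\<lambda>n. ball_frequency (G n) r U w)"
    unfolding convergent_def by auto
qed

end
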